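(* Let $q$ be a fixed power of $2$, and let $i_U(n,q)$ denote the number of involutions in the finite unitary group $U(n,q)$. (1) As $n\to\infty$ through even integers, $$\lim_{n \rightarrow \infty} \frac{i_U(n,q)}{q^{n^2/2}} = \prod_{k \geq 1} \frac{(1-q^{3-8k})(1-q^{5-8k})(1-q^{-8k})}{(1-q^{-2k})}.$$ (2) As $n\to\infty$ through odd integers, $$\lim_{n \rightarrow \infty} \frac{i_U(n,q)}{q^{(n^2-1)/2}} = \prod_{k \geq 1} \frac{(1-q^{1-8k})(1-q^{7-8k})(1-q^{-8k})}{(1-q^{-2k})}.$$
   Context: $U(n,q)$ is the (general) unitary group: the subgroup of $GL(n,q^2)$ (invertible $n\times n$ matrices over the field with $q^2$ elements) stabilizing a nondegenerate Hermitian form on $\mathbb{F}_{q^2}^n$ (unique up to conjugacy; one may take the standard basis to be orthonormal). "Involution" means an element $g$ with $g^2=1$ (the identity is counted). *)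

theory Defs
  imports
    "HOL-Analysis.Infinite_Products"
    "Jordan_Normal_Form.Matrix"
begin

text \<open>
  The finite field with \<open>q\<^sup>2\<close> elements is a type \<open>'a :: {field, finite}\<close> with \<open>CARD('a) = q\<^sup>2\<close>;
  its automorphism of order two over the subfield with \<open>q\<close> elements is \<open>c \<mapsto> c ^ q\<close>.
  The Hermitian form below is the one for which the standard basis is orthonormal.
\<close>

definition hermitian_form :: "nat \<Rightarrow> 'a :: {field, finite} vec \<Rightarrow> 'a vec \<Rightarrow> 'a" where
  "hermitian_form q x y = scalar_prod x (map_vec (\<lambda>c. c ^ q) y)"

definition general_linear_group :: "nat \<Rightarrow> 'a :: {field, finite} mat set" where
  "general_linear_group n = {g \<in> carrier_mat n n. invertible_mat g}"

definition unitary_group :: "nat \<Rightarrow> nat \<Rightarrow> 'a :: {field, finite} mat set" where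
  "unitary_group n q =
     {g \<in> general_linear_group n.
        \<forall>x \<in> carrier_vec n. \<forall>y \<in> carrier_vec n.
          hermitian_form q (g *\<^sub>v x) (g *\<^sub>v y) = hermitian_form q x y}"

text \<open>
  The identity counts as an involution. The type argument selects the coefficient field.
\<close>

definition i_U :: "'a :: {field, finite} itself \<Rightarrow> nat \<Rightarrow> nat \<Rightarrow> nat" where
  "i_U _ n q = card {g :: 'a mat. g \<in> unitary_group n q \<and> g * g = 1\<^sub>m n}"

end

theory Submission
  imports
    Defs
    "HOL-Number_Theory.Residues"
    "HOL-Computational_Algebra.Polynomial"
    "HOL-Analysis.Uniform_Limit"
begin

text \<open>
  In characteristic two, \<open>g \<mapsto> N = g + 1\<close> identifies the unitary involutions with the Hermitian
  matrices \<open>N\<close> with \<open>N\<^sup>2 = 0\<close>. Adding a rank one matrix \<open>v v\<^sup>*\<close>, with \<open>v\<close> an isotropic vector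
  of \<open>ker N\<close> outside \<open>(ker N)\<^sup>\<bottom>\<close>, raises the rank by one, and every such matrix of rank \<open>r + 1\<close>
  arises in this way. Counting these steps from both ends gives a recursion in \<open>r\<close> with solution
  \<open>q ^ (2 r (n - r)) P\<^sub>n / (P\<^sub>r P\<^bsub>n-2r\<^esub>)\<close>, where \<open>P\<^sub>k = \<Prod>i=1..k. 1 - x ^ i\<close> and \<open>x = - 1 / q\<close>.

  After normalisation, Tannery's theorem turns the sum over \<open>r\<close> into
  \<open>\<Sum>s. x ^ (2 s\<^sup>2) / P\<^bsub>2s\<^esub>\<close> for even \<open>n\<close> and \<open>\<Sum>s. x ^ (2 s (s + 1)) / P\<^bsub>2s+1\<^esub>\<close> for odd \<open>n\<close>.
  These are the even and odd parts, in a square root \<open>y\<close> of \<open>x\<close>, of Euler's series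
  \<open>\<Sum>m. y ^ (m\<^sup>2) / P\<^sub>m = \<Prod>k. 1 + y x ^ k\<close>. By the Jacobi triple product, the latter is a theta
  series in \<open>y\<close> divided by \<open>\<Prod>k. 1 - x ^ (2 k + 2)\<close>, and its even and odd parts are again triple
  products (Slater's identities).
\<close>

section \<open>Finite fields of characteristic two and square order\<close>

text \<open>The solution of the recursion is the count for the general linear group with
  \<open>q\<close> replaced by \<open>- q\<close> (Ennola duality); hence the negative base
  \<open>x\<close>. It turns the factors \<open>1 + x ^ e\<close> with odd \<open>e\<close> into
  \<open>1 - q^(-e)\<close>, the shape of the stated products, but it also makes the square root
  \<open>y\<close> of \<open>x\<close> imaginary. The series identities are therefore proved over
  any complete normed field, used over the complex numbers and read back over the reals.

  The count by steps works because the number of steps out of a matrix and into it depends only on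
  its rank. Instead of an appeal to Witt's theorem or to centraliser orders, matrices are sorted by
  the number of steps that build them, and each quantity in the count is followed through a single
  step. The only field arithmetic involved is the size of the fibres of the norm
  \<open>c * c ^ q\<close> and of the trace \<open>c + c ^ q\<close>.

  Every nonzero matrix can be stepped down because the trace is not identically zero: this rules out
  \<open>form (N w) w = 0\<close> for all \<open>w\<close>, which is the obstruction that
  alternating forms would meet.\<close>

lemma card_eq_sum_fibres:
  assumes "finite A" "finite B" "f ` A \<subseteq> B"
  shows "card A = (\<Sum>b\<in>B. card {a \<in> A. f a = b})"
  using sum.group[OF assms, of "\<lambda>_. 1::nat"] by simp

text \<open>Pigeonhole: if every fibre has at most \<open>k\<close> elements and the total is at
  least \<open>card B * k\<close>, no fibre can fall short. It turns root bounds for polynomials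
  into exact fibre sizes.\<close>

lemma card_fibre_eq:
  assumes "finite A" "finite B" "f ` A \<subseteq> B"
    and le: "\<And>b. b \<in> B \<Longrightarrow> card {a \<in> A. f a = b} \<le> k"
    and large: "card B * k \<le> card A" and "b \<in> B"
  shows "card {a \<in> A. f a = b} = k"
proof (rule ccontr)
  assume "card {a \<in> A. f a = b} \<noteq> k"
  with le[OF \<open>b \<in> B\<close>] have "card {a \<in> A. f a = b} < k" by simp
  then have "(\<Sum>b\<in>B. card {a \<in> A. f a = b}) < (\<Sum>b\<in>B. k)"
    using le \<open>finite B\<close> \<open>b \<in> B\<close> by (intro sum_strict_mono_ex1) auto
  with large show False
    by (simp add: card_eq_sum_fibres[OF assms(1-3), symmetric])
qed

lemma sum_if_const:
  fixes a b :: nat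
  assumes "finite T"
  shows "(\<Sum>x\<in>T. if P x then a else b) =
    a * card {x \<in> T. P x} + b * (card T - card {x \<in> T. P x})"
proof -
  have "T \<inter> {x. P x} = {x \<in> T. P x}" "T \<inter> - {x. P x} = T - {x \<in> T. P x}" by auto
  then show ?thesis
    using assms by (simp add: sum.If_cases card_Diff_subset)
qed

lemma card_roots_monic_le:
  fixes r :: "'a :: idom poly"
  assumes "degree r < k"
  shows "card {x. x ^ k + poly r x = 0} \<le> k"
proof -
  let ?p = "monom 1 k + r"
  have "degree ?p = k"
    using assms by (subst degree_add_eq_left) (auto simp: degree_monom_eq)
  moreover from this have "?p \<noteq> 0" using assms by force
  ultimately show ?thesis
    using card_poly_roots_bound[of ?p] by (simp add: poly_monom)
qed

text \<open>Multiplication by a nonzero \<open>x\<close> permutes the nonzero elements, so their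
  product can be cancelled.\<close>

lemma power_CARD_eq_self:
  fixes x :: "'a :: {field, finite}"
  shows "x ^ CARD('a) = x"
proof (cases "x = 0")
  case False
  have "(\<Prod>y\<in>UNIV-{0}. x * y) = (\<Prod>y\<in>UNIV-{0}. y)"
    by (rule prod.reindex_bij_witness[of _ "\<lambda>y. y / x" "\<lambda>y. x * y"]) (use False in auto)
  moreover have "(\<Prod>y\<in>UNIV-{0}. x * y) = x ^ (CARD('a) - 1) * \<Prod>(UNIV-{0})"
    by (simp add: prod.distrib)
  ultimately have "x ^ (CARD('a) - 1) = 1" by simp
  then show ?thesis
    by (metis Suc_diff_1 finite_UNIV_card_ge_0 finite_class.finite_UNIV mult_1_right power_Suc)
qed simp

locale quadratic_field_char_2 =
  fixes q m :: nat and K :: "'a :: {field, finite} itself"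
  assumes m_pos: "m \<ge> 1" and q_def: "q = 2 ^ m" and CARD_eq: "CARD('a) = q ^ 2"
begin

lemma q_ge_2: "q \<ge> 2"
  using m_pos power_increasing[of 1 m "2::nat"] by (simp add: q_def)

lemma CHAR_eq_2: "CHAR('a) = 2"
proof -
  have "CHAR('a) dvd 2 ^ (m * 2)"
    using CHAR_dvd_CARD[where 'a = 'a] by (simp add: CARD_eq q_def power_mult)
  moreover have "prime CHAR('a)"
    by (intro prime_CHAR_semidom finite_imp_CHAR_pos) simp
  ultimately show ?thesis
    by (metis prime_dvd_power primes_dvd_imp_eq two_is_prime_nat)
qed

lemma add_self [simp]: "a + a = 0" for a :: 'a
proof -
  have "(2 :: 'a) = 0"
    using of_nat_CHAR[where 'a = 'a] by (simp add: CHAR_eq_2)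
  then show ?thesis by (metis mult_2 mult_zero_left)
qed

lemma add_eq_0_iff_eq: "a + b = 0 \<longleftrightarrow> a = b" for a b :: 'a
  by (metis add_left_cancel add_self)

lemma frob_add: "(a + b) ^ q = a ^ q + b ^ q" for a b :: 'a
  by (rule freshmans_dream') (simp_all add: CHAR_eq_2 q_def)

lemma frob_sum: "sum f A ^ q = (\<Sum>i\<in>A. f i ^ q)" for f :: "'i \<Rightarrow> 'a"
  by (rule freshmans_dream_sum') (simp_all add: CHAR_eq_2 q_def)

lemma frob_frob [simp]: "(a ^ q) ^ q = a" for a :: 'a
  using power_CARD_eq_self[of a] by (simp add: CARD_eq power2_eq_square power_mult)

lemma zero_frob [simp]: "(0 :: 'a) ^ q = 0"
  using q_ge_2 by simp

text \<open>A fibre consists of roots of a polynomial of degree \<open>q + 1\<close>, and nonzero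
  norms are roots of \<open>b ^ (q - 1) = 1\<close>. As \<open>q^2 - 1 = (q - 1) * (q + 1)\<close>,
  both root bounds must be attained.\<close>

lemma card_norm_fibre:
  fixes a :: 'a
  assumes "a ^ q = a"
  shows "card {c. c * c ^ q = a} = (if a = 0 then 1 else q + 1)"
proof (cases "a = 0")
  case False
  define A B where "A = UNIV - {0 :: 'a}" and "B = {b :: 'a. b ^ (q - 1) = 1}"
  have B: "b \<in> B \<longleftrightarrow> b \<noteq> 0 \<and> b ^ q = b" for b
    using q_ge_2 by (cases q) (auto simp: B_def power_0_left split: if_splits)
  have *: "{c \<in> A. c * c ^ q = b} = {c. c * c ^ q = b}" if "b \<noteq> 0" for b
    using that by (auto simp: A_def)
  have "card {c. c * c ^ q = b} \<le> q + 1" for b :: 'a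
    using card_roots_monic_le[of "[:b:]" "q + 1"] by (simp add: add_eq_0_iff_eq)
  moreover have "card B \<le> q - 1"
    using card_roots_monic_le[of "[:1 :: 'a:]" "q - 1"] q_ge_2
    by (simp add: add_eq_0_iff_eq B_def)
  then have "card B * (q + 1) \<le> (q - 1) * (q + 1)"
    using mult_le_mono1 by blast
  then have "card B * (q + 1) \<le> card A"
    by (simp add: A_def CARD_eq power2_eq_square algebra_simps)
  moreover have "(\<lambda>c. c * c ^ q) ` A \<subseteq> B"
    by (auto simp: A_def B power_mult_distrib mult.commute)
  moreover have "a \<in> B" using False assms by (simp add: B)
  ultimately have "card {c \<in> A. c * c ^ q = a} = q + 1"
    by (intro card_fibre_eq[where B = B]) (auto simp: * B)
  then show ?thesis using False by (simp add: *)
next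
  case True
  then have "{c. c * c ^ q = a} = {0}" by auto
  then show ?thesis using True by simp
qed

text \<open>The same pigeonhole, now with \<open>q^2 = q * q\<close>: traces lie among the roots of
  \<open>b ^ q = b\<close>, and each fibre consists of roots of a polynomial of degree
  \<open>q\<close>.\<close>

lemma card_trace_fibre:
  fixes a :: 'a
  assumes "a ^ q = a"
  shows "card {c. c + c ^ q = a} = q"
proof -
  define B where "B = {b :: 'a. b ^ q = b}"
  have "{c. c + c ^ q = b} = {c. c ^ q + poly [:b, 1:] c = 0}" for b :: 'a
    using add_eq_0_iff_eq[of "c + c ^ q" b for c] by (simp add: ac_simps)
  then have "card {c. c + c ^ q = b} \<le> q" for b :: 'a
    using card_roots_monic_le[of "[:b, 1:]" q] q_ge_2 by simp
  moreover have "card B \<le> q"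
    using card_roots_monic_le[of "[:0, 1 :: 'a:]" q] q_ge_2 
    by (simp add: add_eq_0_iff_eq B_def)
  then have "card B * q \<le> CARD('a)"
    by (simp add: CARD_eq power2_eq_square)
  moreover have "(\<lambda>c. c + c ^ q) ` UNIV \<subseteq> B"
    by (auto simp: B_def frob_add)
  moreover have "a \<in> B" using assms by (simp add: B_def)
  ultimately have "card {c \<in> UNIV. c + c ^ q = a} = q"
    by (intro card_fibre_eq[where B = B]) auto
  then show ?thesis by simp
qed

end

section \<open>The Hermitian form\<close>

lemma carrier_vec_0: "carrier_vec 0 = {0\<^sub>v 0}"
  by (simp only: carrier_vec_def vec_of_dim_0 singleton_conv)

lemma carrier_vec_Suc_cases:
  assumes "x \<in> carrier_vec (Suc n)"
  obtains a v where "x = vCons a v" and "v \<in> carrier_vec n"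
proof (cases x)
  case vNil
  then have "dim_vec x = 0" by (simp only: dim_vec)
  with assms show ?thesis by (metis carrier_vecD nat.distinct(1))
next
  case (vCons a v)
  with assms that show ?thesis by simp
qed

lemma finite_card_carrier_vec:
  "finite (carrier_vec n :: 'a :: {zero, finite} vec set) \<and>
   card (carrier_vec n :: 'a vec set) = CARD('a) ^ n"
proof (induction n)
  case 0
  show ?case
    by (simp add: carrier_vec_0 del: zero_vec_zero vec_of_dim_0)
next
  case (Suc n)
  have "bij_betw (\<lambda>(a, v). vCons a v) (UNIV \<times> carrier_vec n) (carrier_vec (Suc n) :: 'a vec set)"
    unfolding bij_betw_def
  proof (intro conjI equalityI subsetI)
    fix x :: "'a vec" assume "x \<in> carrier_vec (Suc n)"
    then show "x \<in> (\<lambda>(a, v). vCons a v) ` (UNIV \<times> carrier_vec n)"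
      by (auto elim!: carrier_vec_Suc_cases)
  qed (auto intro!: inj_onI)
  from bij_betw_finite[OF this] bij_betw_same_card[OF this] Suc show ?case
    by (simp add: card_cartesian_product)
qed

lemma mat_eq_if_mult_vec_eq:
  fixes A B :: "'a :: comm_semiring_1 mat"
  assumes "A \<in> carrier_mat n k" "B \<in> carrier_mat n k"
    and "\<And>x. x \<in> carrier_vec k \<Longrightarrow> A *\<^sub>v x = B *\<^sub>v x"
  shows "A = B"
proof (rule eq_matI)
  fix i j assume ij: "i < dim_row B" "j < dim_col B"
  have "(A *\<^sub>v unit_vec k j) $ i = A $$ (i, j)" "(B *\<^sub>v unit_vec k j) $ i = B $$ (i, j)"
    using assms(1,2) ij by (simp_all)
  then show "A $$ (i, j) = B $$ (i, j)"
    using assms(3)[of "unit_vec k j"] by simp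
qed (use assms(1,2) in auto)

context quadratic_field_char_2
begin

abbreviation form :: "'a vec \<Rightarrow> 'a vec \<Rightarrow> 'a" where
  "form \<equiv> hermitian_form q"

lemma form_sum: "form x y = (\<Sum>i<dim_vec y. x $ i * (y $ i) ^ q)"
  by (simp add: hermitian_form_def scalar_prod_def atLeast0LessThan)

lemma form_commute: "dim_vec x = dim_vec y \<Longrightarrow> form y x = form x y ^ q"
  by (simp add: form_sum frob_sum power_mult_distrib mult.commute)

lemma form_add_left: "dim_vec x = dim_vec z \<Longrightarrow> dim_vec y = dim_vec z \<Longrightarrow>
    form (x + y) z = form x z + form y z"
  by (simp add: form_sum sum.distrib algebra_simps)

lemma form_add_right: "dim_vec x = dim_vec z \<Longrightarrow> dim_vec y = dim_vec z \<Longrightarrow>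
    form x (y + z) = form x y + form x z"
  by (simp add: form_sum sum.distrib algebra_simps frob_add)

lemma form_smult_left: "dim_vec x = dim_vec y \<Longrightarrow> form (c \<cdot>\<^sub>v x) y = c * form x y"
  by (simp add: form_sum sum_distrib_left algebra_simps)

lemma form_smult_right: "form x (c \<cdot>\<^sub>v y) = c ^ q * form x y"
  by (simp add: form_sum sum_distrib_left algebra_simps power_mult_distrib)

lemma form_self_frob: "form x x ^ q = form x x"
  by (rule form_commute[symmetric]) simp

lemma form_nondegenerate:
  assumes "x \<in> carrier_vec n" and "\<And>y. y \<in> carrier_vec n \<Longrightarrow> form x y = 0"
  shows "x = 0\<^sub>v n"
proof (rule eq_vecI)
  fix i assume i: "i < dim_vec (0\<^sub>v n :: 'a vec)"
  then have "form x (unit_vec n i) = (\<Sum>j<n. if j = i then x $ j else 0)"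
    unfolding form_sum by (intro sum.cong) auto
  then show "x $ i = 0\<^sub>v n $ i"
    using i assms(2)[of "unit_vec n i"] by simp
qed (use assms in auto)

text \<open>Prepending a coordinate \<open>a\<close> to \<open>v\<close> gives an isotropic vector
  iff the norm of \<open>a\<close> equals \<open>form v v\<close>: one choice of \<open>a\<close> if
  \<open>v\<close> is isotropic, \<open>q + 1\<close> otherwise. The factor \<open>q\<close> on the
  left avoids negative powers in the closed form, and integers accommodate the sign of
  \<open>(- q) ^ n\<close>.\<close>

lemma card_isotropic_carrier_vec:
  "int q * int (card {v \<in> carrier_vec n. form v v = 0}) =
     int (q ^ 2) ^ n + (int q - 1) * (- int q) ^ n"
proof (induction n)
  case 0
  have "{v \<in> carrier_vec 0. form v v = 0} = {0\<^sub>v 0}"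
    unfolding carrier_vec_0 by (auto simp: form_sum simp del: zero_vec_zero vec_of_dim_0)
  then show ?case by (simp del: zero_vec_zero vec_of_dim_0)
next
  case (Suc n)
  let ?Z = "\<lambda>n. {v \<in> carrier_vec n. form v v = 0}" and ?V = "carrier_vec n :: 'a vec set"
  have fin: "finite ?V" and card: "card ?V = (q ^ 2) ^ n"
    using finite_card_carrier_vec[where 'a = 'a, of n] by (auto simp: CARD_eq)
  have form_vCons: "form (vCons a v) (vCons a v) = 0 \<longleftrightarrow> a * a ^ q = form v v" for a v
  proof -
    have "form (vCons a v) (vCons a v) = a * a ^ q + form v v"
      by (simp add: form_sum sum.lessThan_Suc_shift del: sum.lessThan_Suc)
    then show ?thesis by (simp add: add_eq_0_iff_eq)
  qed
  have "bij_betw (\<lambda>(v, a). vCons a v) (SIGMA v:?V. {a. a * a ^ q = form v v}) (?Z (Suc n))"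
    unfolding bij_betw_def
  proof (intro conjI equalityI subsetI)
    fix x assume "x \<in> ?Z (Suc n)"
    then show "x \<in> (\<lambda>(v, a). vCons a v) ` (SIGMA v:?V. {a. a * a ^ q = form v v})"
      by (auto elim!: carrier_vec_Suc_cases simp: form_vCons)
  qed (auto intro!: inj_onI simp: form_vCons)
  then have "card (?Z (Suc n)) = (\<Sum>v\<in>?V. if form v v = 0 then 1 else q + 1)"
    using fin by (simp add: bij_betw_same_card[symmetric] card_norm_fibre form_self_frob)
  also have "\<dots> = card (?Z n) + (q + 1) * (card ?V - card (?Z n))"
    using sum_if_const[OF fin, of "\<lambda>v. form v v = 0" 1 "q + 1"] by simp
  finally have step: "card (?Z (Suc n)) = card (?Z n) + (q + 1) * (card ?V - card (?Z n))" .
  have diff: "int (card ?V - card (?Z n)) = int (q ^ 2) ^ n - int (card (?Z n))"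
    using card_mono[OF fin, of "?Z n"] by (simp add: card of_nat_diff)
  have "int q * int (card (?Z (Suc n))) =
      int q * (int (card (?Z n)) + (int q + 1) * int (card ?V - card (?Z n)))"
    by (simp only: step of_nat_add of_nat_mult of_nat_1)
  also have "\<dots> = int q * (int q + 1) * int (q ^ 2) ^ n - int q * (int q * int (card (?Z n)))"
    unfolding diff by (simp add: algebra_simps)
  finally have "int q * int (card (?Z (Suc n))) =
      int q * (int q + 1) * int (q ^ 2) ^ n - int q * (int q * int (card (?Z n)))" .
  then show ?case
    unfolding Suc by (simp add: algebra_simps power2_eq_square)
qed

end

locale hermitian_space = quadratic_field_char_2 q m K
  for q m and K :: "'a :: {field, finite} itself" +
  fixes n :: nat
begin

abbreviation V :: "'a vec set" where "V \<equiv> carrier_vec n"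

lemma finite_V [simp]: "finite V" and card_V: "card V = (q ^ 2) ^ n"
  using finite_card_carrier_vec[where 'a = 'a, of n] by (auto simp: CARD_eq)

lemma form_V_simps:
  "x \<in> V \<Longrightarrow> y \<in> V \<Longrightarrow> z \<in> V \<Longrightarrow> form (x + y) z = form x z + form y z"
  "x \<in> V \<Longrightarrow> y \<in> V \<Longrightarrow> z \<in> V \<Longrightarrow> form x (y + z) = form x y + form x z"
  "x \<in> V \<Longrightarrow> y \<in> V \<Longrightarrow> form (c \<cdot>\<^sub>v x) y = c * form x y"
  "x \<in> V \<Longrightarrow> y \<in> V \<Longrightarrow> form x (c \<cdot>\<^sub>v y) = c ^ q * form x y"
  by (simp_all add: form_add_left form_add_right form_smult_left form_smult_right)

lemma form_commute_V: "x \<in> V \<Longrightarrow> y \<in> V \<Longrightarrow> form y x = form x y ^ q"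
  by (rule form_commute) simp

lemma form_0_left [simp]: "y \<in> V \<Longrightarrow> form (0\<^sub>v n) y = 0"
  by (simp add: form_sum)

lemma form_0_right [simp]: "form x (0\<^sub>v n) = 0"
  by (simp add: form_sum)

lemma add_self_vec: "x \<in> V \<Longrightarrow> y \<in> V \<Longrightarrow> x + y + y = x"
  by (intro eq_vecI) (simp_all add: add.assoc)

text \<open>Since \<open>form w v = 1\<close>, every \<open>y\<close> in \<open>W\<close> splits
  uniquely as \<open>x + c w\<close> with \<open>x\<close> orthogonal to \<open>v\<close>: the
  coefficient is \<open>c = form y v\<close>, and in characteristic two adding \<open>c w\<close>
  once more recovers \<open>x\<close>. All later counts take one such direction \<open>w\<close>
  apart.\<close>

lemma card_decompose:
  assumes W: "W \<subseteq> V" "\<And>x c. x \<in> W \<Longrightarrow> x + c \<cdot>\<^sub>v w \<in> W"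
    and vw: "v \<in> V" "w \<in> V" "form w v = 1"
  shows "card {y \<in> W. P y} = (\<Sum>x | x \<in> W \<and> form x v = 0. card {c. P (x + c \<cdot>\<^sub>v w)})"
proof -
  let ?T = "{x \<in> W. form x v = 0}"
  have fin: "finite W" using W(1) finite_V finite_subset by blast
  have "bij_betw (\<lambda>(x, c). x + c \<cdot>\<^sub>v w) (SIGMA x:?T. {c. P (x + c \<cdot>\<^sub>v w)}) {y \<in> W. P y}"
  proof (rule bij_betw_byWitness[where f' = "\<lambda>y. (y + form y v \<cdot>\<^sub>v w, form y v)"])
    have form_add: "form (x + c \<cdot>\<^sub>v w) v = form x v + c" if "x \<in> W" for x c
      using that W(1) vw by (auto simp: form_V_simps)
    have cancel: "x + c \<cdot>\<^sub>v w + c \<cdot>\<^sub>v w = x" if "x \<in> W" for x c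
      using that W(1) vw by (intro add_self_vec) auto
    show "\<forall>p\<in>SIGMA x:?T. {c. P (x + c \<cdot>\<^sub>v w)}.
        (\<lambda>y. (y + form y v \<cdot>\<^sub>v w, form y v)) ((\<lambda>(x, c). x + c \<cdot>\<^sub>v w) p) = p"
      by (auto simp: form_add cancel)
    show "\<forall>y\<in>{y \<in> W. P y}. (\<lambda>(x, c). x + c \<cdot>\<^sub>v w) (y + form y v \<cdot>\<^sub>v w, form y v) = y"
      by (auto simp: cancel)
    show "(\<lambda>(x, c). x + c \<cdot>\<^sub>v w) ` (SIGMA x:?T. {c. P (x + c \<cdot>\<^sub>v w)}) \<subseteq> {y \<in> W. P y}"
      using W(2) by auto
    show "(\<lambda>y. (y + form y v \<cdot>\<^sub>v w, form y v)) ` {y \<in> W. P y} \<subseteq>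
        (SIGMA x:?T. {c. P (x + c \<cdot>\<^sub>v w)})"
      using W(2) by (auto simp: form_add cancel)
  qed
  then show ?thesis
    using fin by (simp add: bij_betw_same_card[symmetric])
qed

lemma card_hyperplane:
  assumes "W \<subseteq> V" "\<And>x c. x \<in> W \<Longrightarrow> x + c \<cdot>\<^sub>v w \<in> W"
    and "v \<in> V" "w \<in> V" "form w v = 1"
  shows "card W = q ^ 2 * card {x \<in> W. form x v = 0}"
  using card_decompose[OF assms, of "\<lambda>_. True"] by (simp add: CARD_eq)

section \<open>Hermitian matrices of square zero\<close>

definition square_zero :: "'a mat set" where
  "square_zero = {N \<in> carrier_mat n n.
     (\<forall>x\<in>V. \<forall>y\<in>V. form (N *\<^sub>v x) y = form x (N *\<^sub>v y)) \<and>
     (\<forall>x\<in>V. N *\<^sub>v (N *\<^sub>v x) = 0\<^sub>v n)}"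

definition ker :: "'a mat \<Rightarrow> 'a vec set" where
  "ker N = {x \<in> V. N *\<^sub>v x = 0\<^sub>v n}"

text \<open>For a Hermitian \<open>N\<close>, the space \<open>perp (ker N)\<close> is the image of
  \<open>N\<close>; its cardinality serves as the record of the rank.\<close>

definition perp :: "'a vec set \<Rightarrow> 'a vec set" where
  "perp W = {u \<in> V. \<forall>w\<in>W. form u w = 0}"

definition rank_one :: "'a vec \<Rightarrow> 'a mat" where
  "rank_one v = mat n n (\<lambda>(i, j). v $ i * (v $ j) ^ q)"

text \<open>Isotropy and membership in the kernel keep the square zero. Lying outside
  \<open>perp (ker N)\<close> provides a \<open>w\<close> in the kernel with
  \<open>form w v = 1\<close>, so that the added matrix really shrinks the kernel.\<close>

definition extensions :: "'a mat \<Rightarrow> 'a vec set" where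
  "extensions N = {v \<in> ker N. form v v = 0 \<and> v \<notin> perp (ker N)}"

lemma square_zeroD:
  assumes "N \<in> square_zero"
  shows "N \<in> carrier_mat n n"
    and "x \<in> V \<Longrightarrow> y \<in> V \<Longrightarrow> form (N *\<^sub>v x) y = form x (N *\<^sub>v y)"
    and "x \<in> V \<Longrightarrow> N *\<^sub>v (N *\<^sub>v x) = 0\<^sub>v n"
    and "x \<in> V \<Longrightarrow> N *\<^sub>v x \<in> V"
  using assms by (auto simp: square_zero_def)

lemma ker_subset: "ker N \<subseteq> V" and perp_subset: "perp W \<subseteq> V"
  by (auto simp: ker_def perp_def)

lemma finite_ker [simp]: "finite (ker N)" and finite_perp [simp]: "finite (perp W)"
  by (rule finite_subset[OF ker_subset finite_V], rule finite_subset[OF perp_subset finite_V])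

lemma ker_add_smult:
  assumes "N \<in> carrier_mat n n" "x \<in> ker N" "w \<in> ker N"
  shows "x + c \<cdot>\<^sub>v w \<in> ker N"
  using assms by (auto simp: ker_def mult_add_distrib_mat_vec[of _ n n] mult_mat_vec[of _ n n])

lemma perp_add_smult:
  assumes "W \<subseteq> V" "x \<in> perp W" "w \<in> perp W"
  shows "x + c \<cdot>\<^sub>v w \<in> perp W"
  using assms by (auto simp: perp_def form_V_simps subset_iff)

lemma smult_vec_zero [simp]: "c \<cdot>\<^sub>v (0\<^sub>v n :: 'a vec) = 0\<^sub>v n"
  by (intro eq_vecI) simp_all

lemma zero_smult_vec [simp]: "x \<in> V \<Longrightarrow> 0 \<cdot>\<^sub>v x = 0\<^sub>v n"
  by (intro eq_vecI) simp_all

lemma rank_one_carrier [simp]: "rank_one v \<in> carrier_mat n n"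
  by (simp add: rank_one_def)

lemma rank_one_mult_vec:
  assumes "v \<in> V" "x \<in> V"
  shows "rank_one v *\<^sub>v x = form x v \<cdot>\<^sub>v v"
proof (rule eq_vecI)
  fix i assume "i < dim_vec (form x v \<cdot>\<^sub>v v)"
  then show "(rank_one v *\<^sub>v x) $ i = (form x v \<cdot>\<^sub>v v) $ i"
    using assms
    by (simp add: rank_one_def form_sum scalar_prod_def sum_distrib_left sum_distrib_right
        atLeast0LessThan mult_ac)
qed (use assms in \<open>simp_all add: rank_one_def\<close>)

lemma add_rank_one_mult_vec:
  assumes "N \<in> carrier_mat n n" "v \<in> V" "x \<in> V"
  shows "(N + rank_one v) *\<^sub>v x = N *\<^sub>v x + form x v \<cdot>\<^sub>v v"
  using assms by (simp add: add_mult_distrib_mat_vec[of _ n n] rank_one_mult_vec)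

lemma add_rank_one_twice:
  "N \<in> carrier_mat n n \<Longrightarrow> N + rank_one v + rank_one v = N"
  by (intro eq_matI) (auto simp: rank_one_def add.assoc)

lemma self_adjoint_add_rank_one:
  assumes "N \<in> square_zero" "v \<in> V" "x \<in> V" "y \<in> V"
  shows "form ((N + rank_one v) *\<^sub>v x) y = form x ((N + rank_one v) *\<^sub>v y)"
  using assms square_zeroD[OF assms(1)] form_commute_V[of v y] form_commute_V[of y v]
  by (simp add: add_rank_one_mult_vec form_V_simps mult.commute)

text \<open>The image of \<open>x\<close> under the new matrix, \<open>N x + form x v * v\<close>,
  lies in \<open>ker N\<close> and is orthogonal to \<open>v\<close>; both summands of the new
  matrix therefore annihilate it.\<close>

lemma square_zero_add_rank_one:
  assumes N: "N \<in> square_zero" and v: "v \<in> ker N" "form v v = 0"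
  shows "N + rank_one v \<in> square_zero"
proof -
  note N' = square_zeroD[OF N]
  have vV: "v \<in> V" and Nv: "N *\<^sub>v v = 0\<^sub>v n" using v by (auto simp: ker_def)
  have "(N + rank_one v) *\<^sub>v ((N + rank_one v) *\<^sub>v x) = 0\<^sub>v n" if x: "x \<in> V" for x
  proof -
    have "form (N *\<^sub>v x + form x v \<cdot>\<^sub>v v) v = 0"
      using x vV N' v Nv by (simp add: form_V_simps)
    moreover have "N *\<^sub>v (N *\<^sub>v x + form x v \<cdot>\<^sub>v v) = 0\<^sub>v n"
      using x vV N' Nv
      by (simp add: mult_add_distrib_mat_vec[of _ n n] mult_mat_vec[of _ n n])
    ultimately show ?thesis
      using x vV N' by (auto simp: add_rank_one_mult_vec)
  qed
  then show ?thesis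
    using N' vV self_adjoint_add_rank_one[OF N]
    unfolding square_zero_def by (simp add: add_carrier_mat)
qed

lemma extensions_witness:
  assumes "N \<in> square_zero" "v \<in> extensions N"
  obtains w where "w \<in> ker N" "form w v = 1"
proof -
  obtain w where w: "w \<in> ker N" "form v w \<noteq> 0" and v: "v \<in> V"
    using assms(2) ker_subset by (auto simp: extensions_def perp_def)
  have "w \<in> V" using w ker_subset by blast
  then have "form w v \<noteq> 0" using w v form_commute_V[of w v] by (metis zero_frob)
  moreover have "inverse (form w v) \<cdot>\<^sub>v w \<in> ker N"
    using w(1) square_zeroD(1)[OF assms(1)] by (auto simp: ker_def mult_mat_vec[of _ n n])
  moreover have "form (inverse (form w v) \<cdot>\<^sub>v w) v = inverse (form w v) * form w v"
    using \<open>w \<in> V\<close> v by (simp add: form_V_simps)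
  ultimately show thesis using that by simp
qed

lemma ker_add_rank_one:
  assumes N: "N \<in> square_zero" and v: "v \<in> V" and w: "w \<in> ker N" "form w v = 1"
  shows "ker (N + rank_one v) = {x \<in> ker N. form x v = 0}"
proof (intro equalityI subsetI)
  note N' = square_zeroD[OF N]
  have wV: "w \<in> V" and Nw: "N *\<^sub>v w = 0\<^sub>v n" using w by (auto simp: ker_def)
  have vw: "form v w = 1" using form_commute_V[OF wV v] w by simp
  fix x assume "x \<in> ker (N + rank_one v)"
  then have x: "x \<in> V" and eq: "N *\<^sub>v x + form x v \<cdot>\<^sub>v v = 0\<^sub>v n"
    using N' v by (auto simp: ker_def add_rank_one_mult_vec)
  \<comment> \<open>Pairing with \<open>w\<close> removes \<open>N x\<close>, because
    \<open>N\<close> is self-adjoint and \<open>N w = 0\<close>, and so isolates the coefficient of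
    \<open>v\<close>.\<close>
  have "form (N *\<^sub>v x + form x v \<cdot>\<^sub>v v) w = form x v"
    using x v wV N' Nw vw by (simp add: form_V_simps)
  then have xv: "form x v = 0"
    unfolding eq using wV by simp
  then have "N *\<^sub>v x = 0\<^sub>v n" using eq N' x v by simp
  with x xv show "x \<in> {x \<in> ker N. form x v = 0}" by (simp add: ker_def)
next
  fix x assume "x \<in> {x \<in> ker N. form x v = 0}"
  then show "x \<in> ker (N + rank_one v)"
    using square_zeroD[OF N] v by (auto simp: ker_def add_rank_one_mult_vec)
qed

text \<open>The inverse step. In characteristic two, adding \<open>rank_one v\<close> also subtracts
  it, and \<open>v = N w\<close> is chosen so that \<open>w\<close> enters the kernel: its new image
  is \<open>v + form w v * v = v + v = 0\<close>. Isotropy of \<open>v\<close> comes from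
  \<open>form (N w) (N w) = form w (N (N w))\<close>.\<close>

lemma remove_rank_one:
  assumes N: "N \<in> square_zero" and w: "w \<in> V" "form (N *\<^sub>v w) w = 1"
  defines "v \<equiv> N *\<^sub>v w"
  shows "N + rank_one v \<in> square_zero" and "v \<in> extensions (N + rank_one v)"
    and "w \<in> ker (N + rank_one v)" and "form w v = 1"
proof -
  note N' = square_zeroD[OF N]
  have v: "v \<in> V" using N' w by (simp add: v_def)
  have Nv: "N *\<^sub>v v = 0\<^sub>v n" using N' w by (simp add: v_def)
  have "form v v = 0" using N' w v Nv by (metis form_0_right v_def)
  have vk: "v \<in> ker N" using v Nv by (simp add: ker_def)
  show N0: "N + rank_one v \<in> square_zero"
    using square_zero_add_rank_one[OF N vk \<open>form v v = 0\<close>] .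
  show wv: "form w v = 1"
    using N'(2)[OF w(1) w(1)] w(2) by (simp add: v_def)
  have "v + v = 0\<^sub>v n" using v by (intro eq_vecI) auto
  then show wk: "w \<in> ker (N + rank_one v)"
    using w v N' wv by (simp add: ker_def add_rank_one_mult_vec flip: v_def)
  have "v \<in> ker (N + rank_one v)"
    using N' v Nv \<open>form v v = 0\<close> by (auto simp: ker_def add_rank_one_mult_vec)
  moreover have "form v w \<noteq> 0" using w by (simp add: v_def)
  ultimately show "v \<in> extensions (N + rank_one v)"
    using wk \<open>form v v = 0\<close> by (auto simp: extensions_def perp_def)
qed

text \<open>Polarisation. If \<open>form (N w) w\<close> vanished identically while some
  \<open>z = form (N x) y\<close> did not, the values at \<open>d x + y\<close> would be the traces
  of \<open>d z\<close>, and the trace would vanish on the whole field, which contradicts its fibre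
  size \<open>q\<close>.\<close>

lemma exists_form_eq_1:
  assumes N: "N \<in> square_zero" and "N \<noteq> 0\<^sub>m n n"
  obtains w where "w \<in> V" "form (N *\<^sub>v w) w = 1"
proof -
  note N' = square_zeroD[OF N]
  have "\<exists>w\<in>V. form (N *\<^sub>v w) w \<noteq> 0"
  proof (rule ccontr)
    assume "\<not> ?thesis"
    then have zero: "form (N *\<^sub>v w) w = 0" if "w \<in> V" for w using that by blast
    have "form (N *\<^sub>v x) y = 0" if x: "x \<in> V" and y: "y \<in> V" for x y
    proof (rule ccontr)
      define z where "z = form (N *\<^sub>v x) y"
      assume "form (N *\<^sub>v x) y \<noteq> 0"
      then have "z \<noteq> 0" by (simp add: z_def)
      have yx: "form (N *\<^sub>v y) x = z ^ q"
        using N' x y by (metis form_commute_V z_def)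
      have "c + c ^ q = 0" for c :: 'a
      proof -
        \<comment> \<open>With this choice \<open>d * z\<close> is the prescribed element
          \<open>c\<close>, so every trace occurs as a value of the form.\<close>
        define d where "d = c / z"
        have "form (N *\<^sub>v (d \<cdot>\<^sub>v x + y)) (d \<cdot>\<^sub>v x + y) = d * z + (d * z) ^ q"
          using N' x y zero[OF x] zero[OF y] yx
          by (simp add: mult_add_distrib_mat_vec[of _ n n] mult_mat_vec[of _ n n]
              form_V_simps power_mult_distrib flip: z_def)
        moreover have "d * z = c" using \<open>z \<noteq> 0\<close> by (simp add: d_def)
        ultimately show ?thesis
          using zero[of "d \<cdot>\<^sub>v x + y"] x y by simp
      qed
      then have "{c :: 'a. c + c ^ q = 0} = UNIV" by blast
      then have "q ^ 2 = q"
        using card_trace_fibre[of 0] by (simp add: CARD_eq)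
      then show False using q_ge_2 by (simp add: power2_eq_square)
    qed
    then have "N *\<^sub>v x = 0\<^sub>m n n *\<^sub>v x" if "x \<in> V" for x
      using that N'(4) form_nondegenerate[of "N *\<^sub>v x" n] by (intro eq_vecI) simp_all
    then show False
      using mat_eq_if_mult_vec_eq[of N n n "0\<^sub>m n n"] N'(1) \<open>N \<noteq> 0\<^sub>m n n\<close> by simp
  qed
  then obtain w where w: "w \<in> V" "form (N *\<^sub>v w) w \<noteq> 0" by blast
  \<comment> \<open>Since \<open>a\<close> is fixed by the Frobenius map, its inverse is a norm
    \<open>c * c ^ q\<close>, and rescaling \<open>w\<close> by \<open>c\<close> multiplies the
    value \<open>a\<close> by that norm.\<close>
  define a where "a = form (N *\<^sub>v w) w"
  have "a ^ q = a"
    using w N' by (metis a_def form_commute_V)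
  then have "inverse a ^ q = inverse a" by (metis power_inverse)
  then have "card {c. c * c ^ q = inverse a} > 0"
    using card_norm_fibre[of "inverse a"] by simp
  then obtain c where c: "c * c ^ q = inverse a"
    by (metis (mono_tags, lifting) Collect_empty_eq card.empty less_irrefl)
  have "form (N *\<^sub>v (c \<cdot>\<^sub>v w)) (c \<cdot>\<^sub>v w) = c * c ^ q * a"
    using w N' by (simp add: mult_mat_vec[of _ n n] form_V_simps a_def)
  then show thesis
    using that[of "c \<cdot>\<^sub>v w"] w c by (simp add: a_def)
qed

text \<open>The square-zero Hermitian matrices of rank \<open>r\<close>, described by how they are
  built. This makes the rank-dependent counts accessible to induction on \<open>r\<close>; that the
  levels are disjoint and exhaust \<open>square_zero\<close> is shown afterwards.\<close>

primrec level :: "nat \<Rightarrow> 'a mat set" where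
  "level 0 = {0\<^sub>m n n}"
| "level (Suc r) = (\<Union>N\<in>level r. (\<lambda>v. N + rank_one v) ` extensions N)"

lemma zero_mat_mult_vec: "x \<in> V \<Longrightarrow> 0\<^sub>m n n *\<^sub>v x = 0\<^sub>v n"
  by (intro eq_vecI) simp_all

lemma extensionsD:
  assumes "v \<in> extensions N"
  shows "v \<in> V" "v \<in> ker N" "form v v = 0"
  using assms ker_subset by (auto simp: extensions_def)

lemma level_subset_square_zero: "level r \<subseteq> square_zero"
proof (induction r)
  case 0
  then show ?case by (simp add: square_zero_def zero_mat_mult_vec)
next
  case (Suc r)
  then show ?case
    by (auto intro!: square_zero_add_rank_one dest: extensionsD)
qed

lemma ex_level:
  assumes "N \<in> square_zero"
  shows "\<exists>r. N \<in> level r"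
  using assms
\<comment> \<open>The measure stands for the codimension of the kernel: removing a rank one matrix
  puts \<open>w\<close> into the kernel and keeps all of the old one.\<close>
proof (induction "card V - card (ker N)" arbitrary: N rule: less_induct)
  case less
  show ?case
  proof (cases "N = 0\<^sub>m n n")
    case True
    then have "N \<in> level 0" by simp
    then show ?thesis ..
  next
    case False
    then obtain w where w: "w \<in> V" "form (N *\<^sub>v w) w = 1"
      using exists_form_eq_1 less.prems by blast
    define v where "v = N *\<^sub>v w"
    note N0 = remove_rank_one[OF less.prems w, folded v_def]
    have v: "v \<in> V" using less.prems w by (simp add: v_def square_zeroD)
    have N: "N + rank_one v + rank_one v = N"
      using less.prems by (intro add_rank_one_twice) (rule square_zeroD)
    have "ker N = {x \<in> ker (N + rank_one v). form x v = 0}"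
      using ker_add_rank_one[OF N0(1) v N0(3,4)] N by simp
    then have "ker N \<subseteq> ker (N + rank_one v)" "w \<notin> ker N" using N0(4) by auto
    then have "ker N \<subset> ker (N + rank_one v)" using N0(3) by blast
    then have "card (ker N) < card (ker (N + rank_one v))"
      by (intro psubset_card_mono) simp_all
    moreover have "card (ker (N + rank_one v)) \<le> card V"
      by (intro card_mono) (simp_all add: ker_subset)
    ultimately obtain r where "N + rank_one v \<in> level r"
      using less.hyps[OF _ N0(1)] by (meson diff_less_mono2 less_le_trans)
    then have "N \<in> level (Suc r)"
      using N0(2) N by (auto intro!: bexI[of _ "N + rank_one v"] image_eqI[of _ _ v])
    then show ?thesis ..
  qed
qed

section \<open>Effect of one extension on the kernel, its orthogonal space and the two vector
  counts\<close>

definition unit_values :: "'a mat \<Rightarrow> 'a vec set" where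
  "unit_values N = {x \<in> V. form (N *\<^sub>v x) x = 1}"

text \<open>This set contains the candidates for steps upwards from \<open>N\<close>;
  \<open>unit_values N\<close> contains the vectors \<open>w\<close> whose images \<open>N w\<close>
  give the steps downwards.\<close>

definition isotropic_kernel :: "'a mat \<Rightarrow> 'a vec set" where
  "isotropic_kernel N = {x \<in> ker N. form x x = 0}"

lemma card_ker_extension:
  assumes N: "N \<in> square_zero" and v: "v \<in> extensions N"
  shows "card (ker N) = q ^ 2 * card (ker (N + rank_one v))"
proof -
  obtain w where w: "w \<in> ker N" "form w v = 1" by (rule extensions_witness[OF assms])
  have "w \<in> V" using w ker_subset by blast
  have "card (ker N) = q ^ 2 * card {x \<in> ker N. form x v = 0}"
    using w \<open>w \<in> V\<close> extensionsD[OF v] ker_add_smult[OF square_zeroD(1)[OF N]]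
    by (intro card_hyperplane[OF ker_subset]) auto
  then show ?thesis
    using ker_add_rank_one[OF N extensionsD(1)[OF v] w] by simp
qed

text \<open>The kernel of \<open>N\<close> is spanned by the new kernel and \<open>w\<close>, so the
  vectors orthogonal to the new kernel that are also orthogonal to \<open>w\<close> are exactly
  those of \<open>perp (ker N)\<close>. They form a hyperplane, because \<open>v\<close> is
  orthogonal to the new kernel but not to \<open>w\<close>.\<close>

lemma card_perp_ker_extension:
  assumes N: "N \<in> square_zero" and v: "v \<in> extensions N"
  shows "card (perp (ker (N + rank_one v))) = q ^ 2 * card (perp (ker N))"
proof -
  obtain w where w: "w \<in> ker N" "form w v = 1" by (rule extensions_witness[OF assms])
  have wV: "w \<in> V" using w ker_subset by blast
  have vV: "v \<in> V" by (rule extensionsD[OF v])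
  have vw: "form v w = 1" using form_commute_V[OF wV vV] w by simp
  have ker: "ker (N + rank_one v) = {x \<in> ker N. form x v = 0}"
    by (rule ker_add_rank_one[OF N vV w])
  have "form v x = 0" if "x \<in> ker (N + rank_one v)" for x
    using that form_commute_V[of x v] vV ker_subset unfolding ker by auto
  then have vp: "v \<in> perp (ker (N + rank_one v))" using vV by (simp add: perp_def)
  have "{u \<in> perp (ker (N + rank_one v)). form u w = 0} = perp (ker N)"
  proof (intro equalityI subsetI)
    fix u assume "u \<in> {u \<in> perp (ker (N + rank_one v)). form u w = 0}"
    then have u: "u \<in> V" "form u w = 0" "\<And>x. x \<in> ker N \<Longrightarrow> form x v = 0 \<Longrightarrow> form u x = 0"
      by (auto simp: perp_def ker)
    have "form u y = 0" if y: "y \<in> ker N" for y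
    proof -
      have yV: "y \<in> V" using y ker_subset by blast
      \<comment> \<open>Removing the \<open>w\<close>-component of \<open>y\<close> yields a vector
        of the new kernel, to which \<open>u\<close> is orthogonal.\<close>
      have "form u (y + form y v \<cdot>\<^sub>v w) = 0"
        using y w wV yV vV ker_add_smult[OF square_zeroD(1)[OF N] y w(1)]
        by (intro u(3)) (simp_all add: form_V_simps)
      then show ?thesis using u wV yV by (simp add: form_V_simps)
    qed
    then show "u \<in> perp (ker N)" using u by (simp add: perp_def)
  qed (use w in \<open>auto simp: perp_def ker\<close>)
  \<comment> \<open>The roles are exchanged here: \<open>v\<close> is the direction and
    \<open>w\<close> defines the hyperplane.\<close>
  moreover have "card (perp (ker (N + rank_one v))) =
      q ^ 2 * card {u \<in> perp (ker (N + rank_one v)). form u w = 0}"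
    using wV vV vw perp_add_smult[OF ker_subset _ vp]
    by (intro card_hyperplane[OF perp_subset]) auto
  ultimately show ?thesis by simp
qed

text \<open>Write a vector as \<open>x + c w\<close> with \<open>x\<close> orthogonal to
  \<open>v\<close>. The old value \<open>form (N x) x\<close> is independent of \<open>c\<close>,
  whereas the new one is \<open>form (N x) x + c * c ^ q\<close>. With \<open>z\<close> the number
  of \<open>x\<close> of old value 1, the old count is \<open>q^2 * z\<close> and the new one is
  \<open>z + (q + 1) * (card T - z)\<close>; eliminating \<open>z\<close> gives the
  relation.\<close>

lemma card_unit_values_extension:
  assumes N: "N \<in> square_zero" and v: "v \<in> extensions N"
  shows "q ^ 2 * card (unit_values (N + rank_one v)) + q * card (unit_values N) = (q + 1) * card V"
proof -
  note N' = square_zeroD[OF N]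
  obtain w where w: "w \<in> ker N" "form w v = 1" by (rule extensions_witness[OF assms])
  have wV: "w \<in> V" and Nw: "N *\<^sub>v w = 0\<^sub>v n" using w by (auto simp: ker_def)
  have vV: "v \<in> V" by (rule extensionsD[OF v])
  have vw: "form v w = 1" using form_commute_V[OF wV vV] w by simp
  define T where "T = {x \<in> V. form x v = 0}"
  have T: "x \<in> V" "form x v = 0" "form v x = 0" if "x \<in> T" for x
    using that vV form_commute_V[of x v] by (auto simp: T_def)
  have fin: "finite T" by (simp add: T_def)
  have closed: "x + c \<cdot>\<^sub>v w \<in> V" if "x \<in> V" for x c using that wV by simp
  have N_eq: "N *\<^sub>v (x + c \<cdot>\<^sub>v w) = N *\<^sub>v x" if "x \<in> V" for x c
    using that wV N' Nw by (simp add: mult_add_distrib_mat_vec[of _ n n] mult_mat_vec[of _ n n])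
  have old: "form (N *\<^sub>v (x + c \<cdot>\<^sub>v w)) (x + c \<cdot>\<^sub>v w) = form (N *\<^sub>v x) x" if "x \<in> V" for x c
    using that wV N' Nw by (simp add: N_eq form_V_simps)
  have new: "form ((N + rank_one v) *\<^sub>v (x + c \<cdot>\<^sub>v w)) (x + c \<cdot>\<^sub>v w) =
      form (N *\<^sub>v x) x + c * c ^ q" if "x \<in> T" for x c
    using T[OF that] wV vV N' Nw w vw
    by (simp add: add_rank_one_mult_vec N_eq form_V_simps)
  have fixed: "(1 + form (N *\<^sub>v x) x) ^ q = 1 + form (N *\<^sub>v x) x" if "x \<in> V" for x
    using that N' form_commute_V[of "N *\<^sub>v x" x] by (simp add: frob_add)
  have shift: "form (N *\<^sub>v x) x + t = 1 \<longleftrightarrow> t = 1 + form (N *\<^sub>v x) x" for x t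
    using add_eq_0_iff_eq[of "form (N *\<^sub>v x) x + t" 1] add_eq_0_iff_eq[of t "1 + form (N *\<^sub>v x) x"]
    by (simp add: ac_simps)
  define z where "z = card {x \<in> T. form (N *\<^sub>v x) x = 1}"
  have "card (unit_values N) = (\<Sum>x\<in>T. card {c :: 'a. form (N *\<^sub>v x) x = 1})"
    unfolding unit_values_def T_def using wV vV w closed
    by (subst card_decompose[where v = v and w = w]) (auto simp: old intro!: sum.cong)
  also have "\<dots> = (\<Sum>x\<in>T. if form (N *\<^sub>v x) x = 1 then q ^ 2 else 0)"
    by (intro sum.cong) (auto simp: CARD_eq)
  also have "\<dots> = q ^ 2 * z"
    using fin by (subst sum_if_const) (simp_all add: z_def)
  finally have Z: "card (unit_values N) = q ^ 2 * z" .
  have VT: "card V = q ^ 2 * card T"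
    unfolding T_def using wV vV w by (intro card_hyperplane) auto
  have "card (unit_values (N + rank_one v)) =
      (\<Sum>x\<in>T. card {c. c * c ^ q = 1 + form (N *\<^sub>v x) x})"
    unfolding unit_values_def using wV vV w closed new
    by (subst card_decompose[where v = v and w = w]) (auto simp: T_def shift intro!: sum.cong)
  also have "\<dots> = (\<Sum>x\<in>T. if form (N *\<^sub>v x) x = 1 then 1 else q + 1)"
    using T fixed by (intro sum.cong) (auto simp: card_norm_fibre add_eq_0_iff_eq)
  also have "\<dots> = z + (q + 1) * (card T - z)"
    using fin by (subst sum_if_const) (simp_all add: z_def)
  finally have Z': "card (unit_values (N + rank_one v)) = z + (q + 1) * (card T - z)" .
  have "z \<le> card T" unfolding z_def using fin by (intro card_mono) auto
  then obtain d where "card T = z + d" using le_Suc_ex by blast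
  then show ?thesis
    unfolding Z Z' VT by (simp add: algebra_simps power2_eq_square)
qed

text \<open>Averaging over the translations by \<open>a v\<close>: they preserve the new kernel,
  since \<open>v\<close> is isotropic, and change the value of the form at \<open>x + c w\<close> by
  the trace of \<open>a * c ^ q\<close>. For \<open>c\<close> nonzero this trace takes each value in
  the fixed field of Frobenius for \<open>q\<close> of the \<open>q^2\<close> scalars
  \<open>a\<close>, so a proportion \<open>1 / q\<close> of the \<open>x\<close> is isotropic after
  translation by \<open>c w\<close>.\<close>

lemma card_isotropic_translates:
  assumes N: "N \<in> square_zero" and v: "v \<in> extensions N"
    and w: "w \<in> ker N" "form w v = 1" and "c \<noteq> 0"
  shows "q * card {x \<in> ker (N + rank_one v). form (x + c \<cdot>\<^sub>v w) (x + c \<cdot>\<^sub>v w) = 0} =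
         card (ker (N + rank_one v))"
proof -
  define T where "T = ker (N + rank_one v)"
  define \<phi> where "\<phi> x = form (x + c \<cdot>\<^sub>v w) (x + c \<cdot>\<^sub>v w)" for x
  note N' = square_zeroD[OF N] and v' = extensionsD[OF v]
  have wV: "w \<in> V" using w ker_subset by blast
  have vw: "form v w = 1" using form_commute_V[OF wV v'(1)] w by simp
  have T_eq: "T = {x \<in> ker N. form x v = 0}"
    unfolding T_def by (rule ker_add_rank_one[OF N v'(1) w])
  have T: "x \<in> V" "form x v = 0" "form v x = 0" if "x \<in> T" for x
    using that v'(1) form_commute_V[of x v] ker_subset by (auto simp: T_eq)
  have fin: "finite T" by (simp add: T_def)
  have translate: "x + a \<cdot>\<^sub>v v \<in> T" if "x \<in> T" for x a
    using that T[OF that] v' ker_add_smult[OF N'(1) _ v'(2)]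
    by (auto simp: T_eq form_V_simps)
  have \<phi>_translate: "\<phi> (x + a \<cdot>\<^sub>v v) = \<phi> x + (a * c ^ q + (a * c ^ q) ^ q)" if "x \<in> T" for x a
    using T[OF that] v' wV w vw unfolding \<phi>_def
    by (simp add: form_V_simps power_mult_distrib algebra_simps)
  have \<phi>_frob: "\<phi> x ^ q = \<phi> x" for x
    unfolding \<phi>_def by (rule form_self_frob)
  have count: "card {a. \<phi> (x + a \<cdot>\<^sub>v v) = 0} = q" if "x \<in> T" for x
  proof -
    have "bij_betw (\<lambda>a. a * c ^ q) {a. \<phi> (x + a \<cdot>\<^sub>v v) = 0} {t. t + t ^ q = \<phi> x}"
      using \<open>c \<noteq> 0\<close> that
      by (intro bij_betwI[where g = "\<lambda>t. t / c ^ q"])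
        (auto simp: \<phi>_translate add_eq_0_iff_eq power_divide power_mult_distrib)
    then show ?thesis
      using card_trace_fibre[OF \<phi>_frob[of x]] by (simp add: bij_betw_same_card)
  qed
  have "card {x \<in> T. \<phi> (x + a \<cdot>\<^sub>v v) = 0} = card {x \<in> T. \<phi> x = 0}" for a
  proof -
    have "bij_betw (\<lambda>x. x + a \<cdot>\<^sub>v v) {x \<in> T. \<phi> (x + a \<cdot>\<^sub>v v) = 0} {x \<in> T. \<phi> x = 0}"
      using T v'(1)
      by (intro bij_betwI[where g = "\<lambda>x. x + a \<cdot>\<^sub>v v"]) (auto simp: translate add_self_vec)
    then show ?thesis by (rule bij_betw_same_card)
  qed
  then have "(\<Sum>x\<in>T. card {a \<in> UNIV. \<phi> (x + a \<cdot>\<^sub>v v) = 0}) =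
      (\<Sum>a\<in>(UNIV :: 'a set). card {x \<in> T. \<phi> x = 0})"
    using fin by (intro sum_multicount_gen) simp_all
  then have "card T * q = q ^ 2 * card {x \<in> T. \<phi> x = 0}"
    using count by (simp add: CARD_eq)
  then show ?thesis
    using q_ge_2 unfolding T_def \<phi>_def by (simp add: power2_eq_square)
qed

text \<open>Slice the old kernel by the coefficient \<open>c\<close> of \<open>w\<close>. The slice
  \<open>c = 0\<close> contributes the new isotropic kernel, and each of the \<open>q^2 - 1\<close>
  others contributes a \<open>q\<close>-th of the new kernel.\<close>

lemma card_isotropic_kernel_extension:
  assumes N: "N \<in> square_zero" and v: "v \<in> extensions N"
  shows "q * card (isotropic_kernel N) =
    q * card (isotropic_kernel (N + rank_one v)) + (q ^ 2 - 1) * card (ker (N + rank_one v))"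
proof -
  obtain w where w: "w \<in> ker N" "form w v = 1" by (rule extensions_witness[OF assms])
  have wV: "w \<in> V" using w ker_subset by blast
  have vV: "v \<in> V" by (rule extensionsD[OF v])
  define T where "T = ker (N + rank_one v)"
  define J where "J c = card {x \<in> T. form (x + c \<cdot>\<^sub>v w) (x + c \<cdot>\<^sub>v w) = 0}" for c
  have fin: "finite T" by (simp add: T_def)
  have "card (isotropic_kernel N) =
      (\<Sum>x\<in>T. card {c \<in> UNIV. form (x + c \<cdot>\<^sub>v w) (x + c \<cdot>\<^sub>v w) = 0})"
    unfolding isotropic_kernel_def T_def ker_add_rank_one[OF N vV w]
    using w wV vV ker_subset ker_add_smult[OF square_zeroD(1)[OF N]]
    by (subst card_decompose[where v = v and w = w]) auto
  also have "\<dots> = (\<Sum>c\<in>UNIV. J c)"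
    using fin by (intro sum_multicount_gen) (simp_all add: J_def)
  also have "\<dots> = J 0 + (\<Sum>c\<in>UNIV - {0}. J c)"
    by (simp add: sum.remove)
  also have "J 0 = card (isotropic_kernel (N + rank_one v))"
  proof -
    have "x + 0 \<cdot>\<^sub>v w = x" if "x \<in> T" for x
      using that wV ker_subset[of "N + rank_one v"] by (auto simp: T_def)
    then show ?thesis
      by (auto simp: J_def isotropic_kernel_def T_def intro!: arg_cong[of _ _ card])
  qed
  finally have "q * card (isotropic_kernel N) =
      q * card (isotropic_kernel (N + rank_one v)) + (\<Sum>c\<in>UNIV - {0}. q * J c)"
    by (simp add: distrib_left sum_distrib_left)
  also have "(\<Sum>c\<in>UNIV - {0}. q * J c) = (\<Sum>c\<in>UNIV - {0 :: 'a}. card T)"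
    using card_isotropic_translates[OF N v w] by (intro sum.cong) (auto simp: J_def T_def)
  also have "\<dots> = (q ^ 2 - 1) * card T"
    by (simp add: CARD_eq)
  finally show ?thesis by (simp add: T_def)
qed

text \<open>By the preceding relations the kernel loses a factor \<open>q^2\<close> per step and its
  orthogonal space gains one. Moreover \<open>q * card (isotropic_kernel N) - card (ker N)\<close>
  does not change at all, which is why the fourth formula has the sign \<open>(- q) ^ n\<close>
  rather than one depending on \<open>r\<close>; its value is that of the zero matrix.\<close>

lemma level_invariants:
  assumes "N \<in> level r"
  shows "card (ker N) * (q ^ 2) ^ r = (q ^ 2) ^ n"
    and "card (perp (ker N)) = (q ^ 2) ^ r"
    and "int q * int (card (unit_values N)) * int (q ^ 2) ^ r =
           int (q ^ 2) ^ n * (int (q ^ 2) ^ r - (- int q) ^ r)"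
    and "int q * int (card (isotropic_kernel N)) =
           int (card (ker N)) + (int q - 1) * (- int q) ^ n"
proof -
  have "card (ker N) * (q ^ 2) ^ r = (q ^ 2) ^ n \<and>
    card (perp (ker N)) = (q ^ 2) ^ r \<and>
    int q * int (card (unit_values N)) * int (q ^ 2) ^ r =
      int (q ^ 2) ^ n * (int (q ^ 2) ^ r - (- int q) ^ r) \<and>
    int q * int (card (isotropic_kernel N)) =
      int (card (ker N)) + (int q - 1) * (- int q) ^ n"
    using assms
  proof (induction r arbitrary: N)
    case 0
    then have N: "N = 0\<^sub>m n n" by simp
    have ker: "ker N = V" by (auto simp: ker_def N zero_mat_mult_vec)
    have "perp V = {0\<^sub>v n}"
      using form_nondegenerate by (auto simp: perp_def)
    moreover have "unit_values N = {}"
      by (auto simp: unit_values_def N zero_mat_mult_vec)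
    ultimately show ?case
      using card_isotropic_carrier_vec[of n]
      by (simp add: ker isotropic_kernel_def card_V)
  next
    case (Suc r)
    then obtain M v where M: "M \<in> level r" and v: "v \<in> extensions M" and N: "N = M + rank_one v"
      by auto
    have M': "M \<in> square_zero" using M level_subset_square_zero by blast
    note IH = Suc.IH[OF M]
    define Q where "Q = int (q ^ 2)"
    have Q: "Q = int q * int q" by (simp add: Q_def power2_eq_square)
    have ker: "card (ker M) = q ^ 2 * card (ker N)"
      unfolding N by (rule card_ker_extension[OF M' v])
    have "Q * int (card (unit_values N)) + int q * int (card (unit_values M)) =
        (int q + 1) * Q ^ n"
      using arg_cong[OF card_unit_values_extension[OF M' v], of int]
      unfolding N card_V Q_def of_nat_add of_nat_mult of_nat_power by simp
    then have step: "Q * int (card (unit_values N)) =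
        (int q + 1) * Q ^ n - int q * int (card (unit_values M))"
      by simp
    have "int q * int (card (unit_values N)) * Q ^ Suc r =
        int q * (Q * int (card (unit_values N))) * Q ^ r"
      by (simp add: algebra_simps)
    also have "\<dots> = int q * (int q + 1) * Q ^ n * Q ^ r -
        int q * (int q * int (card (unit_values M)) * Q ^ r)"
      unfolding step by (simp add: algebra_simps)
    also have "\<dots> = int q * (int q + 1) * Q ^ n * Q ^ r - int q * (Q ^ n * (Q ^ r - (- int q) ^ r))"
      using IH by (simp only: Q_def)
    also have "\<dots> = Q ^ n * (Q ^ Suc r - (- int q) ^ Suc r)"
      by (simp add: Q algebra_simps)
    finally have unit: "int q * int (card (unit_values N)) * Q ^ Suc r =
        Q ^ n * (Q ^ Suc r - (- int q) ^ Suc r)" .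
    have "int q * int (card (isotropic_kernel M)) =
        int q * int (card (isotropic_kernel N)) + (Q - 1) * int (card (ker N))"
      using arg_cong[OF card_isotropic_kernel_extension[OF M' v], of int] q_ge_2
      unfolding N Q_def by (simp add: of_nat_diff)
    moreover have "int (card (ker M)) = Q * int (card (ker N))"
      unfolding ker Q_def by simp
    ultimately have "int q * int (card (isotropic_kernel N)) =
        int (card (ker N)) + (int q - 1) * (- int q) ^ n"
      using IH by (simp add: algebra_simps)
    then show ?case
      using IH ker unit card_perp_ker_extension[OF M' v] by (simp add: N Q_def mult_ac)
  qed
  then show "card (ker N) * (q ^ 2) ^ r = (q ^ 2) ^ n"
    and "card (perp (ker N)) = (q ^ 2) ^ r"
    and "int q * int (card (unit_values N)) * int (q ^ 2) ^ r =
           int (q ^ 2) ^ n * (int (q ^ 2) ^ r - (- int q) ^ r)"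
    and "int q * int (card (isotropic_kernel N)) =
           int (card (ker N)) + (int q - 1) * (- int q) ^ n"
    by blast+
qed

lemma q2_gt_1: "1 < q ^ 2"
  using q_ge_2 by (intro one_less_power) simp_all

lemma level_disjoint:
  assumes "N \<in> level r" "N \<in> level s"
  shows "r = s"
proof -
  have "card (perp (ker N)) = (q ^ 2) ^ r" "card (perp (ker N)) = (q ^ 2) ^ s"
    using assms level_invariants(2) by blast+
  then have "(q ^ 2) ^ r = (q ^ 2) ^ s" by simp
  then show ?thesis using power_inject_exp[OF q2_gt_1] by blast
qed

lemma level_empty:
  assumes "r > n"
  shows "level r = {}"
proof (rule ccontr)
  assume "level r \<noteq> {}"
  then obtain N where "N \<in> level r" by blast
  then have "card (ker N) * (q ^ 2) ^ r = (q ^ 2) ^ n" by (rule level_invariants)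
  then have "(q ^ 2) ^ r dvd (q ^ 2) ^ n" by (metis dvd_triv_right)
  moreover have "(q ^ 2) ^ n > 0" using q_ge_2 by simp
  ultimately have "(q ^ 2) ^ r \<le> (q ^ 2) ^ n" by (rule dvd_imp_le)
  moreover have "(q ^ 2) ^ n < (q ^ 2) ^ r"
    using assms q2_gt_1 by (intro power_strict_increasing)
  ultimately show False by simp
qed

lemma finite_square_zero: "finite square_zero"
proof (rule finite_subset)
  show "square_zero \<subseteq> (\<lambda>f. mat n n (\<lambda>(i, j). f (i, j))) ` ({..<n} \<times> {..<n} \<rightarrow>\<^sub>E UNIV)"
  proof
    fix N assume "N \<in> square_zero"
    then have "N \<in> carrier_mat n n" by (rule square_zeroD)
    then have "N = mat n n (\<lambda>(i, j). restrict (($$) N) ({..<n} \<times> {..<n}) (i, j))"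
      by (intro eq_matI) auto
    then show "N \<in> (\<lambda>f. mat n n (\<lambda>(i, j). f (i, j))) ` ({..<n} \<times> {..<n} \<rightarrow>\<^sub>E UNIV)"
      by (intro image_eqI[where x = "restrict (($$) N) ({..<n} \<times> {..<n})"]) auto
  qed
  show "finite ((\<lambda>f. mat n n (\<lambda>(i, j). f (i, j))) ` ({..<n} \<times> {..<n} \<rightarrow>\<^sub>E (UNIV :: 'a set)))"
    by (intro finite_imageI finite_PiE) auto
qed

lemma finite_level [simp]: "finite (level r)"
  by (rule finite_subset[OF level_subset_square_zero finite_square_zero])

text \<open>The excluded vectors all lie in the isotropic kernel: if \<open>u\<close> is orthogonal
  to \<open>ker N\<close>, which contains every \<open>N y\<close>, then
  \<open>form (N u) y = form u (N y) = 0\<close>, so \<open>u\<close> is in the kernel and hence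
  orthogonal to itself. Subtracting cardinalities is therefore exact.\<close>

lemma card_extensions:
  assumes "N \<in> level r"
  shows "int q * int (card (extensions N)) =
    int (q ^ 2) ^ (n - r) + (int q - 1) * (- int q) ^ n - int q * int (q ^ 2) ^ r"
proof -
  have N: "N \<in> square_zero" using assms level_subset_square_zero by blast
  note N' = square_zeroD[OF N]
  have "r \<le> n" using assms level_empty[of r] by (metis empty_iff not_le)
  have "(q ^ 2) ^ n = (q ^ 2) ^ (n - r) * (q ^ 2) ^ r"
    unfolding power_add[symmetric] using \<open>r \<le> n\<close> by simp
  then have "card (ker N) * (q ^ 2) ^ r = (q ^ 2) ^ (n - r) * (q ^ 2) ^ r"
    using level_invariants(1)[OF assms] by metis
  then have ker: "card (ker N) = (q ^ 2) ^ (n - r)" using q_ge_2 by simp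
  have "u \<in> isotropic_kernel N" if "u \<in> perp (ker N)" for u
  proof -
    have u: "u \<in> V" "\<And>w. w \<in> ker N \<Longrightarrow> form u w = 0" using that by (auto simp: perp_def)
    have "form (N *\<^sub>v u) y = 0" if "y \<in> V" for y
      using u(2)[of "N *\<^sub>v y"] u(1) that N' by (simp add: ker_def)
    then have "N *\<^sub>v u = 0\<^sub>v n" using u(1) by (intro form_nondegenerate N'(4))
    then show ?thesis using u by (auto simp: isotropic_kernel_def ker_def)
  qed
  then have sub: "perp (ker N) \<subseteq> isotropic_kernel N" by blast
  have fin: "finite (isotropic_kernel N)" by (simp add: isotropic_kernel_def)
  have "extensions N = isotropic_kernel N - perp (ker N)"
    by (auto simp: extensions_def isotropic_kernel_def)
  then have "int (card (extensions N)) = int (card (isotropic_kernel N)) - int (card (perp (ker N)))"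
    using card_mono[OF fin sub] by (simp add: card_Diff_subset[OF _ sub] of_nat_diff)
  then have "int q * int (card (extensions N)) =
      int q * int (card (isotropic_kernel N)) - int q * int (card (perp (ker N)))"
    by (simp only: right_diff_distrib)
  then show ?thesis
    using level_invariants(2,4)[OF assms] by (simp only: ker of_nat_power)
qed

text \<open>A decomposition is determined by \<open>v\<close>, its other part being
  \<open>N + rank_one v\<close>, and the admissible \<open>v\<close> are the images
  \<open>N w\<close> of the unit values \<open>w\<close>. The unit values with a given image form a
  coset of \<open>ker N\<close>, so the number of decompositions is
  \<open>card (unit_values N)\<close> divided by \<open>card (ker N)\<close>.\<close>

lemma card_decompositions:
  assumes "N \<in> level (Suc r)"
  shows "int q * int (card {p \<in> Sigma (level r) extensions. fst p + rank_one (snd p) = N}) =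
    int (q ^ 2) ^ Suc r - (- int q) ^ Suc r"
proof -
  have N: "N \<in> square_zero" using assms level_subset_square_zero by blast
  note N' = square_zeroD[OF N]
  define D where "D = (\<lambda>w. N *\<^sub>v w) ` unit_values N"
  have fin: "finite (unit_values N)" by (simp add: unit_values_def)
  have D_V: "v \<in> V" if "v \<in> D" for v
    using that N' by (auto simp: D_def unit_values_def)
  have "bij_betw (\<lambda>v. (N + rank_one v, v)) D
      {p \<in> Sigma (level r) extensions. fst p + rank_one (snd p) = N}"
  proof (intro bij_betwI[where g = snd] funcsetI)
    fix v assume "v \<in> D"
    then obtain w where w: "w \<in> V" "form (N *\<^sub>v w) w = 1" and v: "v = N *\<^sub>v w"
      by (auto simp: D_def unit_values_def)
    note M = remove_rank_one[OF N w, folded v]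
    have undo: "N + rank_one v + rank_one v = N" by (rule add_rank_one_twice[OF N'(1)])
    obtain s where s: "N + rank_one v \<in> level s" using ex_level[OF M(1)] by blast
    then have "N \<in> level (Suc s)"
      using M(2) undo by (auto intro!: bexI[of _ "N + rank_one v"] image_eqI[of _ _ v])
    \<comment> \<open>Disjointness of the levels forces the predecessor into level \<open>r\<close>,
      whichever level it was found in.\<close>
    then have "Suc r = Suc s" by (rule level_disjoint[OF assms])
    then have "s = r" by simp
    then show "(N + rank_one v, v) \<in>
        {p \<in> Sigma (level r) extensions. fst p + rank_one (snd p) = N}"
      using s M(2) undo by simp
  next
    fix p assume "p \<in> {p \<in> Sigma (level r) extensions. fst p + rank_one (snd p) = N}"
    then obtain M v where p: "p = (M, v)" and M: "M \<in> level r" and v: "v \<in> extensions M"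
      and sum: "M + rank_one v = N"
      by auto
    have M': "M \<in> square_zero" using M level_subset_square_zero by blast
    note MD = square_zeroD[OF M'] and v' = extensionsD[OF v]
    obtain w where w: "w \<in> ker M" "form w v = 1" by (rule extensions_witness[OF M' v])
    have wV: "w \<in> V" using w ker_subset by blast
    have Nw: "N *\<^sub>v w = v"
      using w wV v'(1) MD(1) by (simp add: add_rank_one_mult_vec ker_def flip: sum)
    have "form v w = 1" using form_commute_V[OF wV v'(1)] w by simp
    then have "w \<in> unit_values N" using wV by (simp add: unit_values_def Nw)
    then show "snd p \<in> D" using Nw by (auto simp: D_def p)
    show "(N + rank_one (snd p), snd p) = p"
      using add_rank_one_twice[OF MD(1), of v] by (simp add: p flip: sum)
  qed simp
  then have card_D: "card {p \<in> Sigma (level r) extensions. fst p + rank_one (snd p) = N} = card D"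
    by (simp add: bij_betw_same_card)
  have "card {w \<in> unit_values N. N *\<^sub>v w = v} = card (ker N)" if v_D: "v \<in> D" for v
  proof -
    obtain w where w: "w \<in> V" "form (N *\<^sub>v w) w = 1" and v: "v = N *\<^sub>v w"
      using v_D by (auto simp: D_def unit_values_def)
    have "bij_betw (\<lambda>x. x + w) (ker N) {w \<in> unit_values N. N *\<^sub>v w = v}"
    proof (intro bij_betwI[where g = "\<lambda>x. x + w"] funcsetI)
      fix x assume "x \<in> ker N"
      then have x: "x \<in> V" "N *\<^sub>v x = 0\<^sub>v n" by (auto simp: ker_def)
      have "form (N *\<^sub>v w) x = 0" using N'(2)[OF w(1) x(1)] x by simp
      then show "x + w \<in> {w \<in> unit_values N. N *\<^sub>v w = v}"
        using x w N' by (simp add: unit_values_def v mult_add_distrib_mat_vec[of _ n n] form_V_simps)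
    next
      fix x assume "x \<in> {w \<in> unit_values N. N *\<^sub>v w = v}"
      then have x: "x \<in> V" "N *\<^sub>v x = N *\<^sub>v w" by (auto simp: unit_values_def v)
      have "v + v = 0\<^sub>v n" using D_V[OF v_D] by (intro eq_vecI) auto
      then show "x + w \<in> ker N"
        using x w N' by (simp add: ker_def v mult_add_distrib_mat_vec[of _ n n])
    qed (use w in \<open>auto simp: add_self_vec ker_def unit_values_def\<close>)
    then show ?thesis by (simp add: bij_betw_same_card)
  qed
  then have "card (unit_values N) = card D * card (ker N)"
    using card_eq_sum_fibres[OF fin, of D "(*\<^sub>v) N"] fin by (simp add: D_def)
  then have "int (q ^ 2) ^ n * (int (q ^ 2) ^ Suc r - (- int q) ^ Suc r) =
      int q * int (card D) * int (card (ker N) * (q ^ 2) ^ Suc r)"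
    using level_invariants(3)[OF assms] by (simp only: of_nat_mult of_nat_power mult_ac)
  also have "\<dots> = int (q ^ 2) ^ n * (int q * int (card D))"
    unfolding level_invariants(1)[OF assms] by simp
  finally show ?thesis
    using q_ge_2 unfolding card_D by simp
qed

text \<open>Both sides are \<open>q\<close> times the number of pairs of a matrix of level
  \<open>r\<close> and an extension of it, grouped by the starting matrix and by the resulting
  one.\<close>

lemma card_level_recursion:
  assumes "r \<le> n"
  shows "int (card (level r)) *
      (int (q ^ 2) ^ (n - r) + (int q - 1) * (- int q) ^ n - int q * int (q ^ 2) ^ r) =
    int (card (level (Suc r))) * (int (q ^ 2) ^ Suc r - (- int q) ^ Suc r)"
proof -
  let ?E = "Sigma (level r) extensions"
  have fin: "finite (extensions N)" for N
    using finite_subset[OF _ finite_ker[of N]] by (simp add: extensions_def)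
  have "(\<Sum>N\<in>level r. card (extensions N)) = card ?E"
    using fin by simp
  also have "\<dots> = (\<Sum>N\<in>level (Suc r). card {p \<in> ?E. fst p + rank_one (snd p) = N})"
    using fin by (intro card_eq_sum_fibres) (auto simp del: level.simps(2) simp: level.simps(2)[of r])
  finally have "(\<Sum>N\<in>level r. int q * int (card (extensions N))) =
      (\<Sum>N\<in>level (Suc r). int q * int (card {p \<in> ?E. fst p + rank_one (snd p) = N}))"
    by (simp only: of_nat_sum[symmetric] sum_distrib_left[symmetric])
  then show ?thesis
    by (simp add: card_extensions card_decompositions del: level.simps)
qed

section \<open>From levels to unitary involutions\<close>

lemma card_square_zero: "card square_zero = (\<Sum>r\<le>n. card (level r))"
proof -
  have "square_zero = (\<Union>r\<le>n. level r)"
  proof (intro equalityI subsetI)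
    fix N assume "N \<in> square_zero"
    then obtain r where r: "N \<in> level r" using ex_level by blast
    then have "r \<le> n" using level_empty[of r] by (metis empty_iff not_le)
    with r show "N \<in> (\<Union>r\<le>n. level r)" by blast
  qed (use level_subset_square_zero in blast)
  moreover have "card (\<Union>r\<le>n. level r) = (\<Sum>r\<le>n. card (level r))"
    using level_disjoint by (intro card_UN_disjoint) (simp_all, blast)
  ultimately show ?thesis by simp
qed

text \<open>An isometry with \<open>g * g = 1\<close> is its own inverse and hence its own adjoint,
  and in characteristic two \<open>(g + 1)^2 = g^2 + 1\<close>. Adding the identity twice changes
  nothing, so the map is its own inverse.\<close>

lemma i_U_eq_card_square_zero: "i_U TYPE('a) n q = card square_zero"
proof -
  let ?I = "{g :: 'a mat. g \<in> unitary_group n q \<and> g * g = 1\<^sub>m n}"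
  have twice: "g + 1\<^sub>m n + 1\<^sub>m n = g" if "g \<in> carrier_mat n n" for g :: "'a mat"
    using that by (intro eq_matI) (auto simp: add.assoc)
  have mult: "(g + 1\<^sub>m n) *\<^sub>v x = g *\<^sub>v x + x" if "g \<in> carrier_mat n n" "x \<in> V" for g :: "'a mat" and x
    using that by (simp add: add_mult_distrib_mat_vec[of _ n n])
  have vec_twice: "x + x = 0\<^sub>v n" if "x \<in> V" for x
    using that by (intro eq_vecI) auto
  have "bij_betw (\<lambda>g. g + 1\<^sub>m n) ?I square_zero"
  proof (intro bij_betwI[where g = "\<lambda>g. g + 1\<^sub>m n"] funcsetI)
    fix g assume "g \<in> ?I"
    then have g: "g \<in> carrier_mat n n" "g * g = 1\<^sub>m n"
      and iso: "\<And>x y. x \<in> V \<Longrightarrow> y \<in> V \<Longrightarrow> form (g *\<^sub>v x) (g *\<^sub>v y) = form x y"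
      by (simp_all add: unitary_group_def general_linear_group_def)
    have gg: "g *\<^sub>v (g *\<^sub>v x) = x" if "x \<in> V" for x
      using that g by (metis assoc_mult_mat_vec one_mult_mat_vec)
    have gV: "g *\<^sub>v x \<in> V" if "x \<in> V" for x using that g by simp
    have adj: "form (g *\<^sub>v x) y = form x (g *\<^sub>v y)" if "x \<in> V" "y \<in> V" for x y
      using that iso[of x "g *\<^sub>v y"] gg gV by simp
    have "g *\<^sub>v (g *\<^sub>v x + x) + (g *\<^sub>v x + x) = 0\<^sub>v n" if x: "x \<in> V" for x
    proof -
      have "g *\<^sub>v (g *\<^sub>v x + x) = g *\<^sub>v x + x"
        using x g gg gV comm_add_vec[of x n "g *\<^sub>v x"]
        by (simp add: mult_add_distrib_mat_vec[of _ n n])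
      then show ?thesis using vec_twice x gV by simp
    qed
    then show "g + 1\<^sub>m n \<in> square_zero"
      using g gV adj by (simp add: square_zero_def mult form_V_simps)
  next
    fix N assume N: "N \<in> square_zero"
    note N' = square_zeroD[OF N]
    let ?g = "N + 1\<^sub>m n"
    have g: "?g \<in> carrier_mat n n" by simp
    have gg: "?g *\<^sub>v (?g *\<^sub>v x) = x" if "x \<in> V" for x
    proof -
      have "?g *\<^sub>v (?g *\<^sub>v x) = N *\<^sub>v (N *\<^sub>v x) + N *\<^sub>v x + (N *\<^sub>v x + x)"
        using that N' by (simp add: mult mult_add_distrib_mat_vec[of _ n n])
      also have "\<dots> = x"
        using that N' vec_twice[of "N *\<^sub>v x"] by (simp flip: assoc_add_vec[of _ n])
      finally show ?thesis .
    qed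
    have sq: "?g * ?g = 1\<^sub>m n"
      using gg assoc_mult_mat_vec[OF g g]
      by (intro mat_eq_if_mult_vec_eq[OF mult_carrier_mat[OF g g]]) simp_all
    have "form (?g *\<^sub>v x) (?g *\<^sub>v y) = form x y" if "x \<in> V" "y \<in> V" for x y
    proof -
      have "form (?g *\<^sub>v x) z = form x (?g *\<^sub>v z)" if "z \<in> V" for z
        using that \<open>x \<in> V\<close> N' by (simp add: mult form_V_simps)
      from this[OF mult_mat_vec_carrier[OF g that(2)]] show ?thesis
        using gg[OF that(2)] by simp
    qed
    moreover have "invertible_mat ?g"
      using sq g by (auto simp: invertible_mat_def inverts_mat_def square_mat.simps)
    ultimately show "?g \<in> ?I"
      using g sq by (simp add: unitary_group_def general_linear_group_def)
  qed (auto intro!: twice simp: unitary_group_def general_linear_group_def square_zeroD)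
  then show ?thesis unfolding i_U_def by (rule bij_betw_same_card)
qed

end

section \<open>Slater's identities\<close>

definition qpoch :: "'a :: real_normed_field \<Rightarrow> nat \<Rightarrow> 'a" where
  "qpoch x n = (\<Prod>i<n. 1 - x ^ Suc i)"

lemma qpoch_0 [simp]: "qpoch x 0 = 1"
  and qpoch_Suc: "qpoch x (Suc n) = qpoch x n * (1 - x ^ Suc n)"
  by (simp_all add: qpoch_def)

lemma power_Suc_neq_1:
  fixes x :: "'a :: real_normed_field"
  assumes "norm x < 1"
  shows "x ^ Suc n \<noteq> 1"
proof
  assume "x ^ Suc n = 1"
  then have "norm x ^ Suc n = 1" by (metis norm_one norm_power)
  moreover have "norm x ^ Suc n < 1"
    using assms mult_left_le[of "norm x ^ n" "norm x"] power_le_one[of "norm x" n] by simp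
  ultimately show False by simp
qed

lemma qpoch_nonzero:
  fixes x :: "'a :: real_normed_field"
  assumes "norm x < 1"
  shows "qpoch x n \<noteq> 0"
  unfolding qpoch_def using power_Suc_neq_1[OF assms] by (simp add: eq_commute[of 1])

text \<open>That the limit is nonzero matters as much as its existence: it bounds the inverses too,
  and these bounds dominate every series below.\<close>

lemma qpoch_limit:
  fixes x :: "'a :: {real_normed_field, banach}"
  assumes "norm x < 1"
  obtains l where "qpoch x \<longlonglongrightarrow> l" "l \<noteq> 0"
proof -
  have "summable (\<lambda>i. norm x * norm x ^ i)"
    using assms by (intro summable_mult summable_geometric) simp
  then have "abs_convergent_prod (\<lambda>i. 1 - x ^ Suc i)"
    by (simp add: abs_convergent_prod_conv_summable norm_power norm_mult)
  then have "convergent_prod (\<lambda>i. 1 - x ^ Suc i)"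
    by (rule abs_convergent_prod_imp_convergent_prod)
  then obtain l where "(\<lambda>n. \<Prod>i\<le>n. 1 - x ^ Suc i) \<longlonglongrightarrow> l" "l \<noteq> 0"
    using power_Suc_neq_1[OF assms]
    by (subst (asm) convergent_prod_iff_nz_lim) (auto simp: eq_commute[of 1])
  then have "(\<lambda>n. qpoch x (Suc n)) \<longlonglongrightarrow> l"
    by (simp add: qpoch_def lessThan_Suc_atMost)
  then show thesis
    using that \<open>l \<noteq> 0\<close> by (simp only: filterlim_sequentially_Suc)
qed

section \<open>Gaussian binomials and Euler's product\<close>

definition qbinomial :: "'a :: real_normed_field \<Rightarrow> nat \<Rightarrow> nat \<Rightarrow> 'a" where
  "qbinomial x n k = (if k \<le> n then qpoch x n / (qpoch x k * qpoch x (n - k)) else 0)"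

lemma qbinomial_0:
  assumes "norm x < 1" shows "qbinomial x n 0 = 1"
  using qpoch_nonzero[OF assms] by (simp add: qbinomial_def)

text \<open>The case \<open>k = n\<close> is covered because \<open>qbinomial x n (Suc n)\<close> is
  0 by definition.\<close>

lemma qbinomial_Suc_Suc:
  assumes "norm x < 1" and "k \<le> n"
  shows "qbinomial x (Suc n) (Suc k) = qbinomial x n (Suc k) + x ^ (n - k) * qbinomial x n k"
proof (cases "k = n")
  case True
  then show ?thesis
    using qpoch_nonzero[OF assms(1)] by (simp add: qbinomial_def)
next
  case False
  then obtain d where n: "n = Suc (k + d)"
    using assms(2) less_imp_Suc_add by (metis le_neq_implies_less)
  have nz: "1 - x ^ Suc k \<noteq> 0" "1 - x ^ Suc d \<noteq> 0"
    using power_Suc_neq_1[OF assms(1)] by (auto simp: eq_commute[of 1])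
  have idx: "Suc n - Suc k = Suc d" "n - Suc k = d" "n - k = Suc d" by (simp_all add: n)
  \<comment> \<open>This is \<open>1 - u * v = (1 - v) + v * (1 - u)\<close>, with \<open>u\<close>
    and \<open>v\<close> the last powers in the two denominator products.\<close>
  have frac: "P * (1 - u * v) / (A * (1 - u) * (B * (1 - v))) =
      P / (A * (1 - u) * B) + v * (P / (A * (B * (1 - v))))"
    if "A \<noteq> 0" "B \<noteq> 0" "1 - u \<noteq> 0" "1 - v \<noteq> 0" for P A B u v :: 'a
    using that by (simp add: divide_simps) (simp add: algebra_simps)
  have eq: "x ^ Suc n = x ^ Suc k * x ^ Suc d"
    by (simp add: n power_add mult_ac)
  have cond: "Suc k \<le> Suc n" "Suc k \<le> n" "k \<le> n" by (simp_all add: n)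
  show ?thesis
    using frac[OF qpoch_nonzero[OF assms(1), of k] qpoch_nonzero[OF assms(1), of d] nz, of "qpoch x n"]
    by (simp only: qbinomial_def cond if_True idx qpoch_Suc eq)
qed

lemma choose_2_Suc: "Suc n choose 2 = (n choose 2) + n"
  by (simp add: numeral_2_eq_2)

lemma double_choose_2: "2 * (n choose 2) + n = n * n"
  by (induction n) (simp_all add: choose_2_Suc numeral_2_eq_2)

lemma choose_2_add: "(m + n) choose 2 = (m choose 2) + (n choose 2) + m * n"
  by (induction m) (simp_all add: choose_2_Suc)

theorem qbinomial_theorem:
  fixes x :: "'a :: real_normed_field"
  assumes "norm x < 1"
  shows "(\<Prod>k<n. 1 + z * x ^ k) = (\<Sum>k\<le>n. x ^ (k choose 2) * qbinomial x n k * z ^ k)"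
proof (induction n)
  case 0
  then show ?case by (simp add: qbinomial_def numeral_2_eq_2)
next
  case (Suc n)
  define F where "F n k = x ^ (k choose 2) * qbinomial x n k * z ^ k" for n k
  have step: "F (Suc n) (Suc k) = F n (Suc k) + z * x ^ n * F n k" if "k \<le> n" for k
  proof -
    have "x ^ n = x ^ k * x ^ (n - k)" using that by (simp flip: power_add)
    then show ?thesis
      using qbinomial_Suc_Suc[OF assms that]
      by (simp add: F_def choose_2_Suc power_add algebra_simps)
  qed
  have "(\<Sum>k\<le>Suc n. F (Suc n) k) = F n 0 + (\<Sum>k\<le>n. F n (Suc k) + z * x ^ n * F n k)"
    unfolding sum.atMost_Suc_shift using step by (simp add: F_def qbinomial_0[OF assms])
  also have "\<dots> = (\<Sum>k\<le>Suc n. F n k) + z * x ^ n * (\<Sum>k\<le>n. F n k)"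
    unfolding sum.atMost_Suc_shift by (simp add: sum.distrib sum_distrib_left)
  also have "F n (Suc n) = 0" by (simp add: F_def qbinomial_def)
  then have "(\<Sum>k\<le>Suc n. F n k) = (\<Sum>k\<le>n. F n k)" by simp
  finally show ?case
    using Suc by (simp add: F_def algebra_simps)
qed

lemma summable_choose_2:
  fixes t z :: real
  assumes "0 \<le> t" "t < 1" "0 \<le> z"
  shows "summable (\<lambda>k. t ^ (k choose 2) * z ^ k)"
proof -
  have "(\<lambda>k. t ^ k * z) \<longlonglongrightarrow> 0"
    using assms by (intro tendsto_mult_left_zero LIMSEQ_power_zero) simp
  then have "eventually (\<lambda>k. t ^ k * z < 1 / 2) sequentially"
    by (rule order_tendstoD(2)) simp
  then obtain N where N: "t ^ k * z < 1 / 2" if "k \<ge> N" for k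
    by (auto simp: eventually_sequentially)
  show ?thesis
  proof (rule summable_ratio_test[where c = "1 / 2" and N = N])
    fix k assume "N \<le> k"
    then have "(t ^ k * z) * (t ^ (k choose 2) * z ^ k) \<le> 1 / 2 * (t ^ (k choose 2) * z ^ k)"
      using N[of k] assms by (intro mult_right_mono) auto
    then show "norm (t ^ (Suc k choose 2) * z ^ Suc k) \<le> 1 / 2 * norm (t ^ (k choose 2) * z ^ k)"
      using assms by (simp add: choose_2_Suc power_add mult_ac)
  qed simp
qed

lemma qpoch_bounds:
  fixes x :: "'a :: {real_normed_field, banach}"
  assumes "norm x < 1"
  obtains B where "B \<ge> 0" "\<And>n. norm (qpoch x n) \<le> B" "\<And>n. norm (inverse (qpoch x n)) \<le> B"
proof -
  obtain l where l: "qpoch x \<longlonglongrightarrow> l" "l \<noteq> 0" by (rule qpoch_limit[OF assms])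
  obtain B1 where B1: "\<And>n. norm (qpoch x n) \<le> B1"
    using l convergent_imp_Bseq[of "qpoch x"] by (auto simp: convergent_def Bseq_def)
  have "(\<lambda>n. inverse (qpoch x n)) \<longlonglongrightarrow> inverse l" by (intro tendsto_inverse l)
  then obtain B2 where B2: "\<And>n. norm (inverse (qpoch x n)) \<le> B2"
    using convergent_imp_Bseq[of "\<lambda>n. inverse (qpoch x n)"] by (auto simp: convergent_def Bseq_def)
  show thesis
  proof (rule that[of "max B1 B2"])
    show "max B1 B2 \<ge> 0" using B1[of 0] norm_ge_zero[of "qpoch x 0"] by linarith
  qed (simp_all add: le_max_iff_disj B1 B2)
qed

text \<open>The finite sums grow in length with \<open>n\<close>, so they are padded by zeros to
  full series before dominated convergence is applied; the bound on \<open>g\<close> is then only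
  required inside the range of summation.\<close>

lemma tannery_truncated:
  fixes w :: "nat \<Rightarrow> 'a :: {real_normed_field, banach}"
  assumes "summable (\<lambda>k. norm (w k))"
    and lim: "\<And>k. (\<lambda>n. g n k) \<longlonglongrightarrow> l k"
    and bound: "\<And>n k. k \<le> n \<Longrightarrow> norm (g n k) \<le> B"
  shows "(\<lambda>n. \<Sum>k\<le>n. w k * g n k) \<longlonglongrightarrow> (\<Sum>k. w k * l k)"
proof -
  define a where "a k n = (if k \<le> n then w k * g n k else 0)" for k n
  have "B \<ge> 0" using bound[of 0 0] norm_ge_zero order_trans by blast
  have "(\<lambda>n. a k n) \<longlonglongrightarrow> w k * l k" for k
  proof (rule Lim_transform_eventually)
    show "(\<lambda>n. w k * g n k) \<longlonglongrightarrow> w k * l k" by (intro tendsto_intros lim)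
    show "eventually (\<lambda>n. w k * g n k = a k n) sequentially"
      using eventually_ge_at_top[of k] by eventually_elim (simp add: a_def)
  qed
  moreover have "norm (a k n) \<le> norm (w k) * B" for k n
    using bound[of k n] \<open>B \<ge> 0\<close> by (auto simp: a_def norm_mult intro!: mult_left_mono)
  then have "eventually (\<lambda>(k, n). norm (a k n) \<le> norm (w k) * B) (at_top \<times>\<^sub>F sequentially)"
    by (intro always_eventually) auto
  moreover have "summable (\<lambda>k. norm (w k) * B)" using assms(1) by (rule summable_mult2)
  ultimately have "(\<lambda>n. \<Sum>k. a k n) \<longlonglongrightarrow> (\<Sum>k. w k * l k)"
    using tannerys_theorem[of a "\<lambda>k. w k * l k" sequentially "\<lambda>k. norm (w k) * B"] by simp
  moreover have "(\<Sum>k. a k n) = (\<Sum>k\<le>n. w k * g n k)" for n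
    using suminf_finite[of "{..n}" "\<lambda>k. a k n"] by (simp add: a_def)
  ultimately show ?thesis by simp
qed

lemma qbinomial_norm_le:
  fixes x :: "'a :: {real_normed_field, banach}"
  assumes "norm x < 1"
  obtains B where "\<And>n k. norm (qbinomial x n k) \<le> B"
proof -
  obtain B where B: "B \<ge> 0" "\<And>n. norm (qpoch x n) \<le> B" "\<And>n. norm (inverse (qpoch x n)) \<le> B"
    by (rule qpoch_bounds[OF assms]) auto
  have "norm (qbinomial x n k) \<le> B * (B * B)" for n k
  proof (cases "k \<le> n")
    case True
    then have "norm (qbinomial x n k) =
        norm (qpoch x n) * (norm (inverse (qpoch x k)) * norm (inverse (qpoch x (n - k))))"
      by (simp add: qbinomial_def divide_inverse norm_mult)
    also have "\<dots> \<le> B * (B * B)"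
      using B by (intro mult_mono) (auto intro: mult_nonneg_nonneg)
    finally show ?thesis .
  qed (use B in \<open>simp add: qbinomial_def\<close>)
  then show thesis using that by blast
qed

text \<open>The limit of the \<open>q\<close>-binomial theorem: for fixed \<open>k\<close> the
  Gaussian binomial tends to \<open>1 / qpoch x k\<close>, and all of them are uniformly
  bounded.\<close>

theorem euler_product:
  fixes x :: "'a :: {real_normed_field, banach}"
  assumes x: "norm x < 1"
  shows "(\<lambda>n. \<Prod>k<n. 1 + z * x ^ k) \<longlonglongrightarrow> (\<Sum>k. x ^ (k choose 2) * z ^ k / qpoch x k)"
proof -
  obtain l where l: "qpoch x \<longlonglongrightarrow> l" "l \<noteq> 0" by (rule qpoch_limit[OF x])
  obtain B where B: "\<And>n k. norm (qbinomial x n k) \<le> B" by (rule qbinomial_norm_le[OF x]) auto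
  have lim: "(\<lambda>n. qbinomial x n k) \<longlonglongrightarrow> 1 / qpoch x k" for k
  proof (rule Lim_transform_eventually)
    show "(\<lambda>n. qpoch x n / (qpoch x k * qpoch x (n - k))) \<longlonglongrightarrow> 1 / qpoch x k"
    proof -
      have "(\<lambda>n. qpoch x n / (qpoch x k * qpoch x (n - k))) \<longlonglongrightarrow> l / (qpoch x k * l)"
        using l qpoch_nonzero[OF x]
        by (intro tendsto_intros filterlim_compose[OF l(1) filterlim_minus_const_nat_at_top]) auto
      then show ?thesis using l by simp
    qed
    show "eventually (\<lambda>n. qpoch x n / (qpoch x k * qpoch x (n - k)) = qbinomial x n k) sequentially"
      using eventually_ge_at_top[of k] by eventually_elim (simp add: qbinomial_def)
  qed
  have "summable (\<lambda>k. norm (x ^ (k choose 2) * z ^ k))"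
    using summable_choose_2[of "norm x" "norm z"] x by (simp add: norm_mult norm_power)
  from tannery_truncated[OF this lim B]
  have "(\<lambda>n. \<Sum>k\<le>n. x ^ (k choose 2) * z ^ k * qbinomial x n k) \<longlonglongrightarrow>
      (\<Sum>k. x ^ (k choose 2) * z ^ k * (1 / qpoch x k))" .
  then show ?thesis
    by (simp add: qbinomial_theorem[OF x] mult_ac)
qed

section \<open>Ramanujan's theta function and the Jacobi triple product\<close>

definition theta_term :: "'a :: monoid_mult \<Rightarrow> 'a \<Rightarrow> nat \<Rightarrow> 'a" where
  "theta_term a b j = a ^ (Suc j choose 2) * b ^ (j choose 2)"

lemma prod_lessThan_add:
  "(\<Prod>k<n + m. f k) = (\<Prod>k<n. f k) * (\<Prod>k<m. f (k + n))"
  for f :: "nat \<Rightarrow> 'a :: comm_monoid_mult"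
  by (induction m) (simp_all add: mult_ac add.commute)

text \<open>The \<open>q\<close>-binomial theorem with \<open>2 n\<close> factors, recentred at the
  middle index. Ramanujan's theta series runs over all integers \<open>j\<close>; replacing
  \<open>j\<close> by \<open>- j\<close> exchanges \<open>a\<close> and \<open>b\<close> in
  \<open>theta_term\<close>, so the negative half appears as the second sum.\<close>

lemma finite_jacobi_triple_product:
  fixes a b :: "'a :: real_normed_field"
  assumes nz: "a \<noteq> 0" "b \<noteq> 0" and p: "p = a * b" "norm p < 1"
  shows "(\<Prod>k<n. (1 + a * p ^ k) * (1 + b * p ^ k)) =
    (\<Sum>j\<le>n. theta_term a b j * qbinomial p (2 * n) (n + j)) +
    (\<Sum>j<n. theta_term b a (Suc j) * qbinomial p (2 * n) (n - Suc j))"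
proof -
  have p0: "p \<noteq> 0" using nz p by simp
  \<comment> \<open>The shift by \<open>p ^ n\<close> puts the factors \<open>1 + a * p ^ k\<close>
    in the upper half of the product; multiplying by \<open>c\<close> converts the lower
    half.\<close>
  define z where "z = a / p ^ n"
  define c where "c = (\<Prod>i<n. b * p ^ i)"
  have c: "c = b ^ n * p ^ (n choose 2)"
  proof -
    have "(\<Prod>i<n. b * p ^ i) = b ^ n * p ^ (n choose 2)" for n
      by (induction n) (simp_all add: choose_2_Suc power_add numeral_2_eq_2 mult_ac)
    then show ?thesis by (simp add: c_def)
  qed
  have z_power: "z ^ k = a ^ k / p ^ (n * k)" for k
    by (simp add: z_def power_divide power_mult)
  have "(\<Prod>k<2 * n. 1 + z * p ^ k) = (\<Prod>k<n. 1 + z * p ^ k) * (\<Prod>k<n. 1 + z * p ^ (k + n))"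
    unfolding mult_2 by (rule prod_lessThan_add)
  also have "(\<Prod>k<n. 1 + z * p ^ (k + n)) = (\<Prod>k<n. 1 + a * p ^ k)"
    using p0 by (intro prod.cong) (simp_all add: z_def power_add)
  also have "c * ((\<Prod>k<n. 1 + z * p ^ k) * (\<Prod>k<n. 1 + a * p ^ k)) =
      (\<Prod>k<n. (1 + a * p ^ k) * (1 + b * p ^ k))"
  proof -
    have "(\<Prod>k<n. 1 + z * p ^ k) = (\<Prod>i<n. 1 + z * p ^ (n - Suc i))"
      by (rule prod.nat_diff_reindex[symmetric])
    then have "c * (\<Prod>k<n. 1 + z * p ^ k) = (\<Prod>i<n. b * p ^ i * (1 + z * p ^ (n - Suc i)))"
      by (simp add: c_def prod.distrib)
    also have "\<dots> = (\<Prod>i<n. 1 + b * p ^ i)"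
    proof (intro prod.cong refl)
      fix i assume "i \<in> {..<n}"
      then have "p ^ n = p ^ (n - Suc i) * (p * p ^ i)"
        by (simp flip: power_add power_Suc)
      \<comment> \<open>Reversing the lower half pairs each \<open>b * p ^ i\<close> with the
        reciprocal power, so \<open>b * p ^ i * (1 + z * p ^ (n - Suc i))\<close> becomes
        \<open>b * p ^ i + 1\<close>.\<close>
      then have "b * p ^ i * (z * p ^ (n - Suc i)) = (a * b) / p"
        using p0 by (simp add: z_def field_simps)
      also have "\<dots> = 1" using p0 p by simp
      finally show "b * p ^ i * (1 + z * p ^ (n - Suc i)) = 1 + b * p ^ i"
        by (simp add: algebra_simps)
    qed
    finally show ?thesis by (simp add: prod.distrib mult_ac)
  qed
  finally have "(\<Prod>k<n. (1 + a * p ^ k) * (1 + b * p ^ k)) = c * (\<Prod>k<2 * n. 1 + z * p ^ k)"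
    by simp
  also have "\<dots> = (\<Sum>k\<le>2 * n. c * p ^ (k choose 2) * z ^ k * qbinomial p (2 * n) k)"
    by (simp add: qbinomial_theorem[OF p(2)] sum_distrib_left mult_ac)
  also have "\<dots> = (\<Sum>k\<in>{n..2 * n}. c * p ^ (k choose 2) * z ^ k * qbinomial p (2 * n) k) +
      (\<Sum>k<n. c * p ^ (k choose 2) * z ^ k * qbinomial p (2 * n) k)"
  proof -
    have *: "{..2 * n} = {n..2 * n} \<union> {..<n}" by auto
    show ?thesis unfolding * by (rule sum.union_disjoint) auto
  qed
  also have "(\<Sum>k\<in>{n..2 * n}. c * p ^ (k choose 2) * z ^ k * qbinomial p (2 * n) k) =
      (\<Sum>j\<le>n. c * p ^ ((n + j) choose 2) * z ^ (n + j) * qbinomial p (2 * n) (n + j))"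
    by (rule sum.reindex_bij_witness[of _ "\<lambda>j. n + j" "\<lambda>k. k - n"]) auto
  also have "\<dots> = (\<Sum>j\<le>n. theta_term a b j * qbinomial p (2 * n) (n + j))"
  proof (intro sum.cong refl)
    fix j
    \<comment> \<open>The extra \<open>n\<close> makes this an identity without subtraction in the
      natural numbers; the corresponding factor \<open>p ^ n\<close> is cancelled at the
      end.\<close>
    have e: "((n + j) choose 2) + (n choose 2) + n = (j choose 2) + n * (n + j)"
      using double_choose_2[of n] by (simp add: choose_2_add algebra_simps)
    have "c * p ^ ((n + j) choose 2) * z ^ (n + j) * p ^ n =
        b ^ n * a ^ (n + j) * (p ^ (((n + j) choose 2) + (n choose 2) + n) / p ^ (n * (n + j)))"
      by (simp add: c z_power power_add distrib_left mult_ac)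
    also have "\<dots> = b ^ n * a ^ (n + j) * p ^ (j choose 2)"
      unfolding e using p0 by (simp add: power_add)
    also have "\<dots> = theta_term a b j * p ^ n"
      by (simp add: theta_term_def p(1) choose_2_Suc power_add power_mult_distrib mult_ac)
    finally have "c * p ^ ((n + j) choose 2) * z ^ (n + j) = theta_term a b j"
      using p0 by simp
    then show "c * p ^ ((n + j) choose 2) * z ^ (n + j) * qbinomial p (2 * n) (n + j) =
        theta_term a b j * qbinomial p (2 * n) (n + j)" by simp
  qed
  also have "(\<Sum>k<n. c * p ^ (k choose 2) * z ^ k * qbinomial p (2 * n) k) =
      (\<Sum>j<n. c * p ^ ((n - Suc j) choose 2) * z ^ (n - Suc j) * qbinomial p (2 * n) (n - Suc j))"
    by (rule sum.nat_diff_reindex[symmetric])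
  also have "\<dots> = (\<Sum>j<n. theta_term b a (Suc j) * qbinomial p (2 * n) (n - Suc j))"
  proof (intro sum.cong refl)
    fix j assume "j \<in> {..<n}"
    define i k where "i = Suc j" and "k = n - Suc j"
    have n: "n = k + i" using \<open>j \<in> {..<n}\<close> by (simp add: i_def k_def)
    have e: "(k choose 2) + (n choose 2) + k = (i choose 2) + n * k"
      using double_choose_2[of k] by (simp add: n choose_2_add algebra_simps)
    have "c * p ^ (k choose 2) * z ^ k * p ^ k =
        b ^ n * a ^ k * (p ^ ((k choose 2) + (n choose 2) + k) / p ^ (n * k))"
      by (simp add: c z_power power_add mult_ac)
    also have "\<dots> = b ^ n * a ^ k * p ^ (i choose 2)"
      unfolding e using p0 by (simp add: power_add)
    also have "\<dots> = theta_term b a i * p ^ k"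
      by (simp add: theta_term_def n p(1) choose_2_Suc power_add power_mult_distrib mult_ac)
    finally have "c * p ^ (k choose 2) * z ^ k = theta_term b a i"
      using p0 by simp
    then show "c * p ^ ((n - Suc j) choose 2) * z ^ (n - Suc j) * qbinomial p (2 * n) (n - Suc j) =
        theta_term b a (Suc j) * qbinomial p (2 * n) (n - Suc j)"
      by (simp add: i_def k_def)
  qed
  finally show ?thesis .
qed

lemma summable_theta_term:
  fixes a b :: "'a :: {real_normed_field, banach}"
  assumes "norm a < 1" "norm b < 1"
  shows "summable (\<lambda>j. norm (theta_term a b j))"
proof -
  have ab: "norm a * norm b < 1"
    using assms mult_strict_mono[of "norm a" 1 "norm b" 1] by simp
  have "norm (theta_term a b j) = (norm a * norm b) ^ (j choose 2) * norm a ^ j" for j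
    by (simp add: theta_term_def choose_2_Suc norm_mult norm_power power_add power_mult_distrib)
  then show ?thesis using summable_choose_2[of "norm a * norm b" "norm a"] ab by simp
qed

text \<open>Near the centre all Gaussian binomials of order \<open>2 n\<close> tend to
  \<open>1 / l\<close>, with \<open>l\<close> the limit of \<open>qpoch p\<close>. Multiplication by
  \<open>qpoch p n\<close> clears this factor.\<close>

theorem jacobi_triple_product:
  fixes a b :: "'a :: {real_normed_field, banach}"
  assumes nz: "a \<noteq> 0" "b \<noteq> 0" and less: "norm a < 1" "norm b < 1" and p: "p = a * b"
  shows "(\<lambda>n. (\<Prod>k<n. (1 + a * p ^ k) * (1 + b * p ^ k)) * qpoch p n) \<longlonglongrightarrow>
    (\<Sum>j. theta_term a b j) + (\<Sum>j. theta_term b a (Suc j))"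
proof -
  have p1: "norm p < 1"
    using less mult_strict_mono[of "norm a" 1 "norm b" 1] by (simp add: p norm_mult)
  obtain l where l: "qpoch p \<longlonglongrightarrow> l" "l \<noteq> 0" by (rule qpoch_limit[OF p1])
  obtain B where B: "\<And>n k. norm (qbinomial p n k) \<le> B" by (rule qbinomial_norm_le[OF p1]) auto
  have top: "filterlim (\<lambda>n. 2 * n) at_top (sequentially :: nat filter)"
    "filterlim (\<lambda>n. n + j) at_top (sequentially :: nat filter)" for j
    by (auto intro!: filterlim_subseq simp: strict_mono_def)
  have core: "(\<lambda>n. qpoch p (2 * n) / (qpoch p (n + j) * qpoch p (n - j))) \<longlonglongrightarrow> 1 / l" for j
  proof -
    have "(\<lambda>n. qpoch p (2 * n) / (qpoch p (n + j) * qpoch p (n - j))) \<longlonglongrightarrow> l / (l * l)"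
      using l by (intro tendsto_intros filterlim_compose[OF l(1)] top filterlim_minus_const_nat_at_top) auto
    then show ?thesis using l by simp
  qed
  have lim1: "(\<lambda>n. qbinomial p (2 * n) (n + j)) \<longlonglongrightarrow> 1 / l" for j
  proof (rule Lim_transform_eventually[OF core[of j]])
    show "eventually (\<lambda>n. qpoch p (2 * n) / (qpoch p (n + j) * qpoch p (n - j)) =
        qbinomial p (2 * n) (n + j)) sequentially"
      using eventually_ge_at_top[of j]
      by eventually_elim (simp add: qbinomial_def mult_2)
  qed
  have lim2: "(\<lambda>n. qbinomial p (2 * n) (n - j)) \<longlonglongrightarrow> 1 / l" for j
  proof (rule Lim_transform_eventually[OF core[of j]])
    show "eventually (\<lambda>n. qpoch p (2 * n) / (qpoch p (n + j) * qpoch p (n - j)) =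
        qbinomial p (2 * n) (n - j)) sequentially"
      using eventually_ge_at_top[of j]
    proof eventually_elim
      case (elim n)
      then have "2 * n - (n - j) = n + j" by simp
      then show ?case by (simp add: qbinomial_def mult.commute)
    qed
  qed
  have 1: "(\<lambda>n. \<Sum>j\<le>n. theta_term a b j * qbinomial p (2 * n) (n + j)) \<longlonglongrightarrow>
      (\<Sum>j. theta_term a b j * (1 / l))"
    by (rule tannery_truncated[OF summable_theta_term[OF less] lim1 B])
  have "summable (\<lambda>j. norm (theta_term b a (Suc j)))"
    using summable_theta_term[OF less(2,1)] by (subst summable_Suc_iff)
  \<comment> \<open>The sum stops at \<open>j < n\<close>; the conditional pads it with a zero at
    \<open>j = n\<close>, where \<open>n - Suc j\<close> would be truncated to 0.\<close>
  then have "(\<lambda>n. \<Sum>j\<le>n. theta_term b a (Suc j) *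
        (if j < n then qbinomial p (2 * n) (n - Suc j) else 0)) \<longlonglongrightarrow>
      (\<Sum>j. theta_term b a (Suc j) * (1 / l))"
  proof (rule tannery_truncated)
    show "(\<lambda>n. if j < n then qbinomial p (2 * n) (n - Suc j) else 0) \<longlonglongrightarrow> 1 / l" for j
    proof (rule Lim_transform_eventually[OF lim2[of "Suc j"]])
      show "eventually (\<lambda>n. qbinomial p (2 * n) (n - Suc j) =
          (if j < n then qbinomial p (2 * n) (n - Suc j) else 0)) sequentially"
        using eventually_gt_at_top[of j] by eventually_elim simp
    qed
    show "norm (if j < n then qbinomial p (2 * n) (n - Suc j) else 0) \<le> B" for n j
      using B order_trans[OF norm_ge_zero B] by simp
  qed
  moreover have "(\<Sum>j\<le>n. theta_term b a (Suc j) *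
        (if j < n then qbinomial p (2 * n) (n - Suc j) else 0)) =
      (\<Sum>j<n. theta_term b a (Suc j) * qbinomial p (2 * n) (n - Suc j))" for n
    by (rule sum.mono_neutral_cong_right) auto
  ultimately have 2: "(\<lambda>n. \<Sum>j<n. theta_term b a (Suc j) * qbinomial p (2 * n) (n - Suc j)) \<longlonglongrightarrow>
      (\<Sum>j. theta_term b a (Suc j) * (1 / l))"
    by simp
  have sums: "summable (theta_term a b)" "summable (\<lambda>j. theta_term b a (Suc j))"
    using summable_norm_cancel[OF summable_theta_term[OF less]]
      summable_norm_cancel[OF summable_theta_term[OF less(2,1)]]
    by (simp_all add: summable_Suc_iff)
  have "(\<Sum>j. theta_term a b j * (1 / l)) + (\<Sum>j. theta_term b a (Suc j) * (1 / l)) =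
      ((\<Sum>j. theta_term a b j) + (\<Sum>j. theta_term b a (Suc j))) * (1 / l)"
    by (simp only: suminf_mult2[OF sums(1), symmetric] suminf_mult2[OF sums(2), symmetric]
        distrib_right)
  then have "(\<lambda>n. \<Prod>k<n. (1 + a * p ^ k) * (1 + b * p ^ k)) \<longlonglongrightarrow>
      ((\<Sum>j. theta_term a b j) + (\<Sum>j. theta_term b a (Suc j))) * (1 / l)"
    using tendsto_add[OF 1 2] by (simp only: finite_jacobi_triple_product[OF nz p p1])
  from tendsto_mult[OF this l(1)] show ?thesis using l by simp
qed

section \<open>Splitting Euler's series and the theta series by parity\<close>

lemma suminf_even_terms:
  fixes g :: "nat \<Rightarrow> 'a :: real_normed_field"
  assumes "summable g" "summable (\<lambda>n. (- 1) ^ n * g n)"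
  shows "(\<lambda>n. g (2 * n)) sums ((suminf g + (\<Sum>n. (- 1) ^ n * g n)) / 2)"
proof -
  have "(\<lambda>n. (g n + (- 1) ^ n * g n) / 2) sums ((suminf g + (\<Sum>n. (- 1) ^ n * g n)) / 2)"
    using assms by (intro sums_divide sums_add summable_sums)
  moreover have "odd n" if "n \<notin> range ((*) 2)" for n :: nat
    using that by (metis evenE rangeI)
  ultimately have "(\<lambda>n. (g (2 * n) + (- 1) ^ (2 * n) * g (2 * n)) / 2) sums
      ((suminf g + (\<Sum>n. (- 1) ^ n * g n)) / 2)"
    by (subst sums_mono_reindex[of "\<lambda>n. 2 * n" "\<lambda>n. (g n + (- 1) ^ n * g n) / 2"])
      (auto simp: strict_mono_def)
  then show ?thesis by simp
qed

lemma suminf_odd_terms: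
  fixes g :: "nat \<Rightarrow> 'a :: real_normed_field"
  assumes "summable g" "summable (\<lambda>n. (- 1) ^ n * g n)"
  shows "(\<lambda>n. g (Suc (2 * n))) sums ((suminf g - (\<Sum>n. (- 1) ^ n * g n)) / 2)"
proof -
  have "(\<lambda>n. (g n - (- 1) ^ n * g n) / 2) sums ((suminf g - (\<Sum>n. (- 1) ^ n * g n)) / 2)"
    using assms by (intro sums_divide sums_diff summable_sums)
  moreover have "even n" if "n \<notin> range (\<lambda>n. Suc (2 * n))" for n :: nat
    using that by (metis oddE Suc_eq_plus1 rangeI)
  ultimately have "(\<lambda>n. (g (Suc (2 * n)) - (- 1) ^ (Suc (2 * n)) * g (Suc (2 * n))) / 2) sums
      ((suminf g - (\<Sum>n. (- 1) ^ n * g n)) / 2)"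
    by (subst sums_mono_reindex[of "\<lambda>n. Suc (2 * n)" "\<lambda>n. (g n - (- 1) ^ n * g n) / 2"])
      (auto simp: strict_mono_def)
  then show ?thesis by simp
qed

definition square_sum :: "'a :: {real_normed_field, banach} \<Rightarrow> 'a \<Rightarrow> 'a" where
  "square_sum x y = (\<Sum>m. y ^ (m * m) / qpoch x m)"

text \<open>Ramanujan's theta function at \<open>y, y ^ 3\<close>, that is, the sum of
  \<open>y ^ (2 j^2 - j)\<close> over all integers \<open>j\<close>.\<close>

definition theta_sum :: "'a :: {real_normed_field, banach} \<Rightarrow> 'a" where
  "theta_sum y = (\<Sum>j. theta_term y (y ^ 3) j) + (\<Sum>j. theta_term (y ^ 3) y (Suc j))"

lemma norm_power_less_1:
  "norm x < 1 \<Longrightarrow> n > 0 \<Longrightarrow> norm (x ^ n) < 1" for x :: "'a :: real_normed_field"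
  by (simp add: norm_power power_less_one_iff)

lemma power_square_eq: "y ^ (m * m) = (y ^ 2) ^ (m choose 2) * y ^ m"
  for y :: "'a :: monoid_mult"
  by (simp add: power_add power_mult flip: double_choose_2[of m])

lemma summable_squares:
  fixes x y :: "'a :: {real_normed_field, banach}"
  assumes "y ^ 2 = x" "norm x < 1"
  shows "summable (\<lambda>m. norm (y ^ (m * m) / qpoch x m))"
proof -
  obtain B where B: "\<And>n. norm (inverse (qpoch x n)) \<le> B"
    by (rule qpoch_bounds[OF assms(2)]) auto
  have "summable (\<lambda>m. norm (y ^ (m * m)))"
    using summable_choose_2[of "norm x" "norm y"] assms
    by (simp add: power_square_eq norm_mult norm_power)
  then show ?thesis
    by (rule summable_comparison_test'[OF summable_mult2[of _ B]])
      (use B in \<open>auto simp: divide_inverse norm_mult intro!: mult_left_mono\<close>)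
qed

text \<open>
  Euler's product and the triple product with parameters \<open>y, y\<^sup>3\<close> both evaluate
  \<open>\<Prod>k. (1 + y ^ (2 * k + 1))\<close>.
\<close>

lemma square_sum_eq_theta_sum:
  fixes x y l :: "'a :: {real_normed_field, banach}"
  assumes y: "y ^ 2 = x" "y \<noteq> 0" "norm y < 1" and l: "qpoch (x ^ 2) \<longlonglongrightarrow> l"
  shows "square_sum x y * l = theta_sum y"
proof -
  have p: "y * y ^ 3 = x ^ 2" by (simp flip: y(1) power_Suc power_mult)
  have y3: "y ^ 3 = y * x" by (simp add: power3_eq_cube power2_eq_square flip: y(1))
  have x: "norm x < 1" using norm_power_less_1[OF y(3), of 2] y(1) by simp
  have "(\<lambda>n. \<Prod>k<n. 1 + y * x ^ k) \<longlonglongrightarrow> square_sum x y"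
    using euler_product[OF x, of y] by (simp add: square_sum_def power_square_eq y(1))
  then have "(\<lambda>n. \<Prod>k<2 * n. 1 + y * x ^ k) \<longlonglongrightarrow> square_sum x y"
    by (rule filterlim_compose) (auto intro!: filterlim_subseq simp: strict_mono_def)
  from tendsto_mult[OF this l]
  have "(\<lambda>n. (\<Prod>k<2 * n. 1 + y * x ^ k) * qpoch (x ^ 2) n) \<longlonglongrightarrow> square_sum x y * l" .
  \<comment> \<open>Consecutive factors are paired: \<open>y * x ^ (2 k + 1)\<close> is
    \<open>y ^ 3 * (x ^ 2) ^ k\<close>.\<close>
  moreover have "(\<Prod>k<2 * n. 1 + y * x ^ k) =
      (\<Prod>k<n. (1 + y * (x ^ 2) ^ k) * (1 + y ^ 3 * (x ^ 2) ^ k))" for n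
    by (induction n) (simp_all add: y3 mult_ac flip: power_mult)
  moreover have "(\<lambda>n. (\<Prod>k<n. (1 + y * (x ^ 2) ^ k) * (1 + y ^ 3 * (x ^ 2) ^ k)) * qpoch (x ^ 2) n)
      \<longlonglongrightarrow> theta_sum y"
    unfolding theta_sum_def
    using y norm_power_less_1[OF y(3), of 3] by (intro jacobi_triple_product) (simp_all add: p)
  ultimately show ?thesis by (simp add: LIMSEQ_unique)
qed

text \<open>
  The terms of the theta series of \<open>y\<close> have the parity of their index as powers of \<open>y\<close>, so that
  passing from \<open>y\<close> to \<open>- y\<close> separates even and odd indices on both sides.
\<close>

lemma choose_2_double: "2 * i choose 2 = 4 * (i choose 2) + i"
  using double_choose_2[of i] by (simp add: mult_2 choose_2_add)

lemma theta_term_powers: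
  "theta_term (t ^ m) (t ^ n) j = t ^ (m * (Suc j choose 2) + n * (j choose 2))"
  for t :: "'a :: comm_ring_1"
  by (simp add: theta_term_def power_add power_mult)

text \<open>The exponents are \<open>2 j^2 - j\<close> in the first series and
  \<open>2 i^2 + i\<close> with \<open>i = j + 1\<close> in the second; the shift of the index
  accounts for the additional minus sign.\<close>

lemma theta_term_uminus:
  fixes y :: "'a :: comm_ring_1"
  shows "theta_term (- y) ((- y) ^ 3) j = (- 1) ^ j * theta_term y (y ^ 3) j"
    and "theta_term ((- y) ^ 3) (- y) (Suc j) = - ((- 1) ^ j * theta_term (y ^ 3) y (Suc j))"
  using theta_term_powers[of "- y" 1 3 j] theta_term_powers[of y 1 3 j]
    theta_term_powers[of "- y" 3 1 "Suc j"] theta_term_powers[of y 3 1 "Suc j"]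
  by (simp_all add: power_minus[of y "_ + _"] minus_one_power_iff choose_2_Suc)

text \<open>Over all integers \<open>j\<close>, the exponent \<open>2 j^2 - j\<close> of
  \<open>y\<close> becomes \<open>2 (4 i^2 - i)\<close> at \<open>j = 2 i\<close> and
  \<open>1 + 2 (4 i^2 + 3 i)\<close> at \<open>j = 2 i + 1\<close>. These are the theta exponents
  for \<open>x ^ 3, x ^ 5\<close> and for \<open>x ^ 7, x\<close>, which is where the residues
  modulo 8 come from.\<close>

lemma theta_term_bisect:
  fixes x y :: "'a :: comm_ring_1"
  assumes "y ^ 2 = x"
  shows "theta_term y (y ^ 3) (2 * i) = theta_term (x ^ 3) (x ^ 5) i"
    and "theta_term (y ^ 3) y (Suc (Suc (2 * i))) = theta_term (x ^ 5) (x ^ 3) (Suc i)"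
    and "theta_term y (y ^ 3) (Suc (2 * i)) = y * theta_term (x ^ 7) x i"
    and "theta_term (y ^ 3) y (Suc (2 * i)) = y * theta_term x (x ^ 7) (Suc i)"
proof -
  have x: "x ^ k = y ^ (2 * k)" for k by (simp add: power_mult assms)
  have x1: "x = y ^ 2" and y1: "y = y ^ 1" by (simp_all add: assms)
  have idx: "1 * (Suc (2 * i) choose 2) + 3 * (2 * i choose 2) =
        2 * 3 * (Suc i choose 2) + 2 * 5 * (i choose 2)"
    "3 * (Suc (Suc (Suc (2 * i))) choose 2) + 1 * (Suc (Suc (2 * i)) choose 2) =
        2 * 5 * (Suc (Suc i) choose 2) + 2 * 3 * (Suc i choose 2)"
    "1 * (Suc (Suc (2 * i)) choose 2) + 3 * (Suc (2 * i) choose 2) =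
        Suc (2 * 7 * (Suc i choose 2) + 2 * (i choose 2))"
    "3 * (Suc (Suc (2 * i)) choose 2) + 1 * (Suc (2 * i) choose 2) =
        Suc (2 * (Suc (Suc i) choose 2) + 2 * 7 * (Suc i choose 2))"
    by (simp_all add: choose_2_Suc choose_2_double)
  note y13 = theta_term_powers[of y 1 3, unfolded power_one_right]
    and y31 = theta_term_powers[of y 3 1, unfolded power_one_right]
  show "theta_term y (y ^ 3) (2 * i) = theta_term (x ^ 3) (x ^ 5) i"
    unfolding x y13 theta_term_powers idx ..
  show "theta_term (y ^ 3) y (Suc (Suc (2 * i))) = theta_term (x ^ 5) (x ^ 3) (Suc i)"
    unfolding x y31 theta_term_powers idx ..
  show "theta_term y (y ^ 3) (Suc (2 * i)) = y * theta_term (x ^ 7) x i"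
    unfolding y13 idx power_Suc
    by (simp only: theta_term_powers[of y "2 * 7" 2 i, symmetric] x[symmetric] assms)
  show "theta_term (y ^ 3) y (Suc (2 * i)) = y * theta_term x (x ^ 7) (Suc i)"
    unfolding y31 idx power_Suc
    by (simp only: theta_term_powers[of y 2 "2 * 7" "Suc i", symmetric] x[symmetric] assms)
qed

text \<open>The identity between Euler's series and the theta series is used at \<open>y\<close> and
  at \<open>- y\<close>. Half the sum of the two gives the first claim; half the difference, divided
  by \<open>y\<close>, gives the second. Only even powers of \<open>y\<close> remain, so both claims
  are in terms of \<open>x\<close>.\<close>

theorem slater_identities:
  fixes x y :: "'a :: {real_normed_field, banach}"
  assumes y: "y ^ 2 = x" "y \<noteq> 0" "norm y < 1"
  shows "(\<lambda>n. (\<Prod>k<n. (1 + x ^ 3 * (x ^ 8) ^ k) * (1 + x ^ 5 * (x ^ 8) ^ k)) * qpoch (x ^ 8) n /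
            qpoch (x ^ 2) n) \<longlonglongrightarrow> (\<Sum>s. x ^ (2 * (s * s)) / qpoch x (2 * s))" (is ?even)
    and "(\<lambda>n. (\<Prod>k<n. (1 + x ^ 7 * (x ^ 8) ^ k) * (1 + x * (x ^ 8) ^ k)) * qpoch (x ^ 8) n /
            qpoch (x ^ 2) n) \<longlonglongrightarrow> (\<Sum>s. x ^ (2 * (s * Suc s)) / qpoch x (Suc (2 * s)))" (is ?odd)
proof -
  have x: "norm x < 1" using norm_power_less_1[OF y(3), of 2] y(1) by simp
  have x0: "x \<noteq> 0" using y by auto
  have my: "(- y) ^ 2 = x" "- y \<noteq> 0" "norm (- y) < 1" using y by simp_all
  have x2: "norm (x ^ 2) < 1" using norm_power_less_1[OF x] by simp
  obtain l where l: "qpoch (x ^ 2) \<longlonglongrightarrow> l" "l \<noteq> 0" by (rule qpoch_limit[OF x2])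
  define A where "A = (\<lambda>m. y ^ (m * m) / qpoch x m)"
  define C where "C = theta_term y (y ^ 3)"
  define D where "D = (\<lambda>j. theta_term (y ^ 3) y (Suc j))"
  define A' where "A' = (\<lambda>m. (- 1) ^ m * A m)"
  define C' where "C' = (\<lambda>j. (- 1) ^ j * C j)"
  define D' where "D' = (\<lambda>j. (- 1) ^ j * D j)"
  have uminus: "(\<lambda>m. (- y) ^ (m * m) / qpoch x m) = A'"
    "theta_term (- y) ((- y) ^ 3) = C'"
    "(\<lambda>j. theta_term ((- y) ^ 3) (- y) (Suc j)) = (\<lambda>j. - D' j)"
    by (simp add: A'_def A_def power_minus[of y "_ * _"] minus_one_power_iff)
      (simp_all only: fun_eq_iff C'_def D'_def C_def D_def theta_term_uminus simp_thms)
  have y3: "norm (y ^ 3) < 1" "norm ((- y) ^ 3) < 1"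
    using norm_power_less_1[of y 3] norm_power_less_1[of "- y" 3] y(3) by simp_all
  have sum_A: "summable A" "summable A'"
    using summable_norm_cancel[OF summable_squares[OF y(1) x]]
      summable_norm_cancel[OF summable_squares[OF my(1) x]]
    unfolding A_def uminus .
  have sum_C: "summable C" "summable C'"
    using summable_norm_cancel[OF summable_theta_term[OF y(3) y3(1)]]
      summable_norm_cancel[OF summable_theta_term[OF my(3) y3(2)]]
    unfolding C_def uminus .
  have sum_D: "summable D"
    using summable_norm_cancel[OF summable_theta_term[OF y3(1) y(3)]]
    unfolding D_def by (simp only: summable_Suc_iff)
  have "summable (\<lambda>j. theta_term ((- y) ^ 3) (- y) (Suc j))"
    using summable_norm_cancel[OF summable_theta_term[OF y3(2) my(3)]]
    by (simp only: summable_Suc_iff)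
  then have sum_D': "summable D'"
    unfolding uminus by (simp only: summable_minus_iff)
  have plus: "suminf A * l = suminf C + suminf D"
    using square_sum_eq_theta_sum[OF y l(1)]
    unfolding square_sum_def theta_sum_def A_def C_def D_def .
  have minus: "suminf A' * l = suminf C' - suminf D'"
    using square_sum_eq_theta_sum[OF my l(1)] sum_D'
    unfolding square_sum_def theta_sum_def uminus by (simp add: suminf_minus)
  have x_power: "x ^ k = y ^ (2 * k)" for k by (simp add: power_mult y(1))
  have p: "x ^ 3 * x ^ 5 = x ^ 8" "x ^ 7 * x = x ^ 8" by (simp_all flip: power_add power_Suc2)
  note even = suminf_even_terms[OF _ sum_A(2)[unfolded A'_def], folded A'_def]
    suminf_even_terms[OF _ sum_C(2)[unfolded C'_def], folded C'_def]
    suminf_even_terms[OF _ sum_D'[unfolded D'_def], folded D'_def]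
  note odd = suminf_odd_terms[OF _ sum_A(2)[unfolded A'_def], folded A'_def]
    suminf_odd_terms[OF _ sum_C(2)[unfolded C'_def], folded C'_def]
    suminf_odd_terms[OF _ sum_D'[unfolded D'_def], folded D'_def]
  note parity = even(1)[OF sum_A(1)] even(2)[OF sum_C(1)] even(3)[OF sum_D]
    odd(1)[OF sum_A(1)] odd(2)[OF sum_C(1)] odd(3)[OF sum_D]
  show ?even
  proof -
    define S where "S = (\<Sum>s. x ^ (2 * (s * s)) / qpoch x (2 * s))"
    define T where "T = suminf (theta_term (x ^ 3) (x ^ 5)) + (\<Sum>i. theta_term (x ^ 5) (x ^ 3) (Suc i))"
    have "2 * s * (2 * s) = 2 * (2 * (s * s))" for s :: nat by simp
    then have "A (2 * s) = x ^ (2 * (s * s)) / qpoch x (2 * s)" for s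
      by (simp only: A_def x_power)
    then have "S = (suminf A + suminf A') / 2"
      using parity(1) by (simp add: sums_iff S_def)
    moreover have "suminf (theta_term (x ^ 3) (x ^ 5)) = (suminf C + suminf C') / 2"
      using parity(2) by (simp add: sums_iff C_def theta_term_bisect(1)[OF y(1)])
    \<comment> \<open>\<open>D\<close> begins with the theta term of index 1, so the terms of even
      index sit at its odd positions; in the second identity it is the other way round.\<close>
    moreover have "(\<Sum>i. theta_term (x ^ 5) (x ^ 3) (Suc i)) = (suminf D - suminf D') / 2"
      using parity(6) by (simp add: sums_iff D_def theta_term_bisect(2)[OF y(1)])
    moreover have "(suminf A + suminf A') / 2 * l = (suminf A * l + suminf A' * l) / 2"
      by (simp add: distrib_right)
    ultimately have "S * l = T"
      unfolding plus minus T_def by (simp add: add_divide_distrib diff_divide_distrib)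
    moreover have "(\<lambda>n. (\<Prod>k<n. (1 + x ^ 3 * (x ^ 8) ^ k) * (1 + x ^ 5 * (x ^ 8) ^ k)) * qpoch (x ^ 8) n)
      \<longlonglongrightarrow> T"
      unfolding T_def using x0 x norm_power_less_1[OF x] p by (intro jacobi_triple_product) simp_all
    ultimately have "(\<lambda>n. (\<Prod>k<n. (1 + x ^ 3 * (x ^ 8) ^ k) * (1 + x ^ 5 * (x ^ 8) ^ k)) * qpoch (x ^ 8) n /
        qpoch (x ^ 2) n) \<longlonglongrightarrow> S * l / l"
      by (simp only: tendsto_divide[OF _ l])
    then show ?thesis using l(2) by (simp add: S_def)
  qed
  show ?odd
  proof -
    define S where "S = (\<Sum>s. x ^ (2 * (s * Suc s)) / qpoch x (Suc (2 * s)))"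
    define T where "T = suminf (theta_term (x ^ 7) x) + (\<Sum>i. theta_term x (x ^ 7) (Suc i))"
    have "Suc (2 * s) * Suc (2 * s) = Suc (2 * (2 * (s * Suc s)))" for s by simp
    then have "A (Suc (2 * s)) = y * (x ^ (2 * (s * Suc s)) / qpoch x (Suc (2 * s)))" for s
      by (simp only: A_def x_power power_Suc times_divide_eq_right)
    then have "A (Suc (2 * s)) / y = x ^ (2 * (s * Suc s)) / qpoch x (Suc (2 * s))" for s
      using y(2) by simp
    then have "S = (suminf A - suminf A') / 2 / y"
      using sums_divide[OF parity(4), of y] by (simp add: sums_iff S_def)
    moreover have "suminf (theta_term (x ^ 7) x) = (suminf C - suminf C') / 2 / y"
      using sums_divide[OF parity(5), of y] y(2) by (simp add: sums_iff C_def theta_term_bisect(3)[OF y(1)])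
    moreover have "(\<Sum>i. theta_term x (x ^ 7) (Suc i)) = (suminf D + suminf D') / 2 / y"
      using sums_divide[OF parity(3), of y] y(2) by (simp add: sums_iff D_def theta_term_bisect(4)[OF y(1)])
    moreover have "(suminf A - suminf A') / 2 / y * l = (suminf A * l - suminf A' * l) / 2 / y"
      by (simp add: left_diff_distrib)
    ultimately have "S * l = T"
      unfolding plus minus T_def by (simp add: add_divide_distrib diff_divide_distrib)
    moreover have "(\<lambda>n. (\<Prod>k<n. (1 + x ^ 7 * (x ^ 8) ^ k) * (1 + x * (x ^ 8) ^ k)) * qpoch (x ^ 8) n)
      \<longlonglongrightarrow> T"
      unfolding T_def using x0 x norm_power_less_1[OF x] p by (intro jacobi_triple_product) simp_all
    ultimately have "(\<lambda>n. (\<Prod>k<n. (1 + x ^ 7 * (x ^ 8) ^ k) * (1 + x * (x ^ 8) ^ k)) * qpoch (x ^ 8) n /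
        qpoch (x ^ 2) n) \<longlonglongrightarrow> S * l / l"
      by (simp only: tendsto_divide[OF _ l])
    then show ?thesis using l(2) by (simp add: S_def)
  qed
qed

section \<open>Transfer to negative real arguments\<close>

lemma qpoch_of_real: "qpoch (of_real x) n = of_real (qpoch x n)"
  by (simp add: qpoch_def)

lemma summable_weighted:
  fixes x :: "'a :: {real_normed_field, banach}"
  assumes x: "norm x < 1"
  shows "summable (\<lambda>s. norm (x ^ (2 * (s * s))))" and "summable (\<lambda>s. norm (x ^ (2 * (s * Suc s))))"
proof -
  have "summable (\<lambda>s. norm x ^ s)" using x by (intro summable_geometric) simp
  then have *: "summable (\<lambda>s. norm (x ^ f s))" if "\<And>s. s \<le> f s" for f
    by (rule summable_comparison_test'[where N = 0])
      (use that x in \<open>simp add: norm_power power_decreasing\<close>)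
  show "summable (\<lambda>s. norm (x ^ (2 * (s * s))))"
    by (rule *) (simp add: trans_le_add1 le_square flip: mult_2)
  show "summable (\<lambda>s. norm (x ^ (2 * (s * Suc s))))"
    by (rule *) simp
qed

lemma summable_weighted_quotient:
  fixes x :: "'a :: {real_normed_field, banach}"
  assumes x: "norm x < 1" and w: "summable (\<lambda>s. norm (w s))"
  shows "summable (\<lambda>s. w s / qpoch x (f s))"
proof -
  obtain B where B: "\<And>n. norm (inverse (qpoch x n)) \<le> B"
    by (rule qpoch_bounds[OF x]) auto
  show ?thesis
    by (rule summable_comparison_test'[OF summable_mult2[OF w, of B]])
      (use B in \<open>auto simp: divide_inverse norm_mult intro!: mult_left_mono\<close>)
qed

text \<open>For negative \<open>x\<close> the required square root exists only over the complex
  numbers. Both sides of the complex identities are images of real numbers, so the limits can be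
  compared in the reals.\<close>

lemma real_slater_identities:
  fixes x :: real
  assumes "- 1 < x" "x < 0"
  shows "(\<lambda>n. \<Prod>k<n. (1 + x ^ (8 * k + 5)) * (1 + x ^ (8 * k + 3)) * (1 - x ^ (8 * k + 8)) /
            (1 - x ^ (2 * k + 2))) \<longlonglongrightarrow> (\<Sum>s. x ^ (2 * (s * s)) / qpoch x (2 * s))"
    and "(\<lambda>n. \<Prod>k<n. (1 + x ^ (8 * k + 7)) * (1 + x ^ (8 * k + 1)) * (1 - x ^ (8 * k + 8)) /
            (1 - x ^ (2 * k + 2))) \<longlonglongrightarrow> (\<Sum>s. x ^ (2 * (s * Suc s)) / qpoch x (Suc (2 * s)))"
proof -
  define y where "y = csqrt (of_real x)"
  have y: "y ^ 2 = of_real x" "y \<noteq> 0" "norm y < 1"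
  proof -
    show eq: "y ^ 2 = of_real x" by (simp only: y_def power2_csqrt)
    then show "y \<noteq> 0" using assms by auto
    have "norm y ^ 2 < 1" using assms by (simp flip: norm_power add: eq)
    then show "norm y < 1" by (simp add: power_less_one_iff)
  qed
  have x: "norm x < 1" using assms by simp
  have even_sum: "(\<Sum>s. complex_of_real x ^ (2 * (s * s)) / qpoch (of_real x) (2 * s)) =
      of_real (\<Sum>s. x ^ (2 * (s * s)) / qpoch x (2 * s))"
    using summable_weighted_quotient[OF x summable_weighted(1)[OF x]]
    by (simp add: qpoch_of_real suminf_of_real flip: of_real_power of_real_divide)
  have odd_sum: "(\<Sum>s. complex_of_real x ^ (2 * (s * Suc s)) / qpoch (of_real x) (Suc (2 * s))) =
      of_real (\<Sum>s. x ^ (2 * (s * Suc s)) / qpoch x (Suc (2 * s)))"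
    using summable_weighted_quotient[OF x summable_weighted(2)[OF x]]
    by (simp add: qpoch_of_real suminf_of_real del: mult_Suc_right flip: of_real_power of_real_divide)
  have pw: "x ^ (8 * k + e) = x ^ e * (x ^ 8) ^ k" for k e
    by (simp add: power_add power_mult)
  have pw2: "x ^ (2 * k + 2) = x ^ 2 * (x ^ 2) ^ k" for k
    by (subst power_add) (simp add: power_mult)
  have prod_eq: "(\<Prod>k<n. (1 + x ^ (8 * k + a)) * (1 + x ^ (8 * k + b)) * (1 - x ^ (8 * k + 8)) /
      (1 - x ^ (2 * k + 2))) =
    (\<Prod>k<n. (1 + x ^ b * (x ^ 8) ^ k) * (1 + x ^ a * (x ^ 8) ^ k)) * qpoch (x ^ 8) n / qpoch (x ^ 2) n"
    for n a b
    unfolding pw pw2 by (induction n) (simp_all add: qpoch_Suc mult_ac)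
  note complex = slater_identities[OF y, unfolded even_sum odd_sum, folded of_real_power]
  show "(\<lambda>n. \<Prod>k<n. (1 + x ^ (8 * k + 5)) * (1 + x ^ (8 * k + 3)) * (1 - x ^ (8 * k + 8)) /
            (1 - x ^ (2 * k + 2))) \<longlonglongrightarrow> (\<Sum>s. x ^ (2 * (s * s)) / qpoch x (2 * s))"
    unfolding prod_eq by (subst tendsto_of_real_iff[where 'a = complex, symmetric])
      (use complex(1) in \<open>simp add: qpoch_of_real flip: of_real_power\<close>)
  show "(\<lambda>n. \<Prod>k<n. (1 + x ^ (8 * k + 7)) * (1 + x ^ (8 * k + 1)) * (1 - x ^ (8 * k + 8)) /
            (1 - x ^ (2 * k + 2))) \<longlonglongrightarrow> (\<Sum>s. x ^ (2 * (s * Suc s)) / qpoch x (Suc (2 * s)))"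
    unfolding prod_eq by (subst tendsto_of_real_iff[where 'a = complex, symmetric])
      (use complex(2) in \<open>simp add: qpoch_of_real mult.commute flip: of_real_power\<close>)
qed

lemma qpoch_pos:
  fixes x :: real
  assumes "- 1 < x" "x < 0"
  shows "qpoch x n > 0"
  unfolding qpoch_def
proof (intro prod_pos)
  fix i
  have "\<bar>x ^ Suc i\<bar> < 1"
    using norm_power_less_1[of x "Suc i"] assms by simp
  then show "0 < 1 - x ^ Suc i" by linarith
qed

section \<open>Asymptotics\<close>

context hermitian_space
begin

text \<open>The recursion gives the quotient of consecutive levels. Its left factor vanishes as soon
  as \<open>n - 2 * r\<close> is 0 or 1, so the levels end at half of \<open>n\<close>, as the rank
  of a square-zero matrix must.\<close>

lemma card_level:
  fixes x :: real
  defines "x \<equiv> - 1 / real q"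
  shows "real (card (level r)) =
    (if 2 * r \<le> n then real q ^ (2 * (r * (n - r))) * qpoch x n / (qpoch x r * qpoch x (n - 2 * r)) else 0)"
proof (induction r)
  case 0
  have "x > - 1" "x < 0" using q_ge_2 by (simp_all add: x_def field_simps)
  then show ?case using qpoch_pos[of x] by (simp add: less_imp_neq[symmetric])
next
  case (Suc r)
  have x: "x > - 1" "x < 0" using q_ge_2 by (simp_all add: x_def field_simps)
  have nz: "qpoch x k \<noteq> 0" for k using qpoch_pos[OF x, of k] by simp
  have q0: "real q > 0" using q_ge_2 by simp
  have xq: "- real q * x = 1" using q0 by (simp add: x_def)
  have fac: "1 - x ^ Suc r \<noteq> 0" using nz[of "Suc r"] by (auto simp: qpoch_Suc)
  show ?case
  proof (cases "r \<le> n")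
    case False
    then show ?thesis using level_empty[of "Suc r"] by simp
  next
    case True
    \<comment> \<open>In terms of \<open>u\<close> the left factor is \<open>q^(2 r)\<close> times
      \<open>u^2 + (q - 1) * u - q\<close>, which splits as
      \<open>(u - 1) * (u + q)\<close>.\<close>
    define u where "u = (- real q) ^ (n - 2 * r)"
    have rec: "real (card (level r)) * (real q ^ (2 * (n - r)) + (real q - 1) * (- real q) ^ n -
        real q * real q ^ (2 * r)) =
      real (card (level (Suc r))) * (real q ^ (2 * Suc r) - (- real q) ^ Suc r)"
      using arg_cong[OF card_level_recursion[OF True], of real_of_int]
      by (simp add: power_mult power2_eq_square del: level.simps)
    have rhs: "real q ^ (2 * Suc r) - (- real q) ^ Suc r = real q ^ (2 * Suc r) * (1 - x ^ Suc r)"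
    proof -
      have "real q ^ (2 * Suc r) * x ^ Suc r = (- real q) ^ Suc r * (- real q * x) ^ Suc r"
        by (simp only: power_mult power_mult_distrib[symmetric]) (simp add: power2_eq_square mult_ac)
      then show ?thesis unfolding xq by (simp add: right_diff_distrib)
    qed
    have rhs0: "real q ^ (2 * Suc r) * (1 - x ^ Suc r) \<noteq> 0" using q0 fac by simp
    show ?thesis
    proof (cases "2 * r \<le> n")
      case False
      then have "real (card (level r)) = 0" using Suc by simp
      then have "real (card (level (Suc r))) = 0" using rec rhs rhs0 by (metis mult_eq_0_iff mult_zero_left)
      then show ?thesis using False by simp
    next
      case le: True
      have e1: "real q ^ (2 * (n - r)) = real q ^ (2 * r) * u ^ 2"
      proof -
        have "2 * (n - r) = 2 * r + 2 * (n - 2 * r)" using le by simp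
        then have "real q ^ (2 * (n - r)) = real q ^ (2 * r) * (real q ^ (n - 2 * r)) ^ 2"
          by (metis power_add power_mult mult.commute)
        then show ?thesis by (simp add: u_def power_minus[of "real q"] power_mult_distrib flip: power_mult)
      qed
      have e2: "(- real q) ^ n = real q ^ (2 * r) * u"
      proof -
        have "(- real q) ^ n = (- real q) ^ (2 * r) * (- real q) ^ (n - 2 * r)"
          using le by (metis power_add le_add_diff_inverse)
        then show ?thesis by (simp add: u_def)
      qed
      have lhs: "real q ^ (2 * (n - r)) + (real q - 1) * (- real q) ^ n - real q * real q ^ (2 * r) =
          real q ^ (2 * r) * ((u - 1) * (u + real q))"
        unfolding e1 e2 by (simp add: algebra_simps power2_eq_square)
      show ?thesis
      proof (cases "2 * Suc r \<le> n")
        case False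
        \<comment> \<open>The two roots occur here: \<open>u = 1\<close> in the first case and
          \<open>u = - q\<close> in the second.\<close>
        then have "n - 2 * r = 0 \<or> n - 2 * r = 1" using le by auto
        then have "(u - 1) * (u + real q) = 0" by (auto simp: u_def)
        then have "real (card (level (Suc r))) = 0"
          using rec lhs rhs rhs0 by (metis mult_eq_0_iff)
        then show ?thesis using False by simp
      next
        case le2: True
        define d where "d = n - 2 * Suc r"
        have d: "n - 2 * r = Suc (Suc d)" "n - 2 * Suc r = d" using le2 by (simp_all add: d_def)
        have P: "qpoch x (n - 2 * r) = qpoch x d * (1 - x ^ Suc d) * (1 - x ^ Suc (Suc d))"
          unfolding d qpoch_Suc ..
        have nz2: "1 - x ^ Suc d \<noteq> 0" "1 - x ^ Suc (Suc d) \<noteq> 0"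
          using nz[of "Suc d"] nz[of "Suc (Suc d)"] by (auto simp: qpoch_Suc)
        have ux: "u * x ^ Suc (Suc d) = 1"
          using power_mult_distrib[of "- real q" x "n - 2 * r"] unfolding xq by (simp add: u_def d)
        have ux1: "u * x ^ Suc d = - real q"
        proof -
          have "u * x ^ Suc d = - real q * x * (u * x ^ Suc d)" unfolding xq by simp
          also have "\<dots> = - real q * (u * x ^ Suc (Suc d))" by (simp add: mult_ac)
          finally show ?thesis unfolding ux by simp
        qed
        \<comment> \<open>As \<open>- q * x = 1\<close>, the number \<open>u\<close> is the inverse
          of \<open>x ^ (n - 2 r)\<close>; pulling it out of each factor leaves the two factors lost
          in passing from \<open>qpoch x (n - 2 r)\<close> to \<open>qpoch x d\<close>.\<close>
        have fact: "(u - 1) * (u + real q) = u ^ 2 * ((1 - x ^ Suc (Suc d)) * (1 - x ^ Suc d))"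
        proof -
          have "u - 1 = u * (1 - x ^ Suc (Suc d))" "u + real q = u * (1 - x ^ Suc d)"
            by (simp_all only: right_diff_distrib ux ux1 mult_1_right diff_minus_eq_add)
          then show ?thesis by (simp add: power2_eq_square mult_ac)
        qed
        have "real (card (level (Suc r))) * (real q ^ (2 * Suc r) * (1 - x ^ Suc r)) =
          real (card (level r)) *
            (real q ^ (2 * (n - r)) * ((1 - x ^ Suc (Suc d)) * (1 - x ^ Suc d)))"
          using rec[unfolded rhs lhs fact] unfolding e1 by (simp add: mult_ac del: level.simps power_Suc)
        also have "real (card (level r)) =
            real q ^ (2 * (r * (n - r))) * qpoch x n / (qpoch x r * qpoch x (n - 2 * r))"
          using Suc le by simp
        also have "\<dots> * (real q ^ (2 * (n - r)) * ((1 - x ^ Suc (Suc d)) * (1 - x ^ Suc d))) =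
            real q ^ (2 * (r * (n - r)) + 2 * (n - r)) * qpoch x n / (qpoch x r * qpoch x d)"
          unfolding P using nz2 nz by (simp add: power_add divide_simps del: power_Suc)
        also have "2 * (r * (n - r)) + 2 * (n - r) = 2 * Suc r + 2 * (Suc r * (n - Suc r))"
        proof -
          \<comment> \<open>Substituting for \<open>n\<close> removes the truncated subtractions
            before the exponents are compared.\<close>
          obtain k where "n = Suc r + k" using le2 le_Suc_ex[of "Suc r" n] by auto
          then show ?thesis by (simp add: algebra_simps)
        qed
        also have "real q ^ (2 * Suc r + 2 * (Suc r * (n - Suc r))) * qpoch x n / (qpoch x r * qpoch x d) =
            real q ^ (2 * (Suc r * (n - Suc r))) * qpoch x n / (qpoch x (Suc r) * qpoch x d) *
            (real q ^ (2 * Suc r) * (1 - x ^ Suc r))"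
          unfolding power_add qpoch_Suc[of x r] using nz fac by (simp add: divide_simps del: power_Suc)
        finally have "real (card (level (Suc r))) =
            real q ^ (2 * (Suc r * (n - Suc r))) * qpoch x n / (qpoch x (Suc r) * qpoch x d)"
          by (rule iffD1[OF mult_right_cancel[OF rhs0]])
        then show ?thesis by (simp only: le2 if_True d(2))
      qed
    qed
  qed
qed

end

section \<open>The normalised counts and their limits\<close>

context quadratic_field_char_2
begin

abbreviation neg_inv :: real where "neg_inv \<equiv> - 1 / real q"

lemma neg_inv_bounds: "- 1 < neg_inv" "neg_inv < 0" "norm neg_inv < 1"
  using q_ge_2 by (simp_all add: field_simps)

text \<open>The index \<open>s = M - r\<close> measures the distance from the maximal rank, where
  the dominant terms are; in this index the summands converge one by one.\<close>

lemma i_U_eq_sum: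
  assumes "n = 2 * M \<or> n = Suc (2 * M)"
  shows "real (i_U TYPE('a) n q) =
    (\<Sum>s\<le>M. real q ^ (2 * ((M - s) * (n - (M - s)))) * qpoch neg_inv n /
      (qpoch neg_inv (M - s) * qpoch neg_inv (n - 2 * (M - s))))"
proof -
  interpret hermitian_space q m K n ..
  have "real (i_U TYPE('a) n q) = (\<Sum>r\<le>n. real (card (level r)))"
    by (simp add: i_U_eq_card_square_zero card_square_zero)
  also have "\<dots> = (\<Sum>r\<le>M. real q ^ (2 * (r * (n - r))) * qpoch neg_inv n / (qpoch neg_inv r * qpoch neg_inv (n - 2 * r)))"
    using assms by (intro sum.mono_neutral_cong_right) (auto simp: card_level)
  also have "\<dots> = (\<Sum>s\<le>M. real q ^ (2 * ((M - s) * (n - (M - s)))) * qpoch neg_inv n /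
      (qpoch neg_inv (M - s) * qpoch neg_inv (n - 2 * (M - s))))"
    by (rule sum.reindex_bij_witness[of _ "\<lambda>s. M - s" "\<lambda>r. M - r"]) auto
  finally show ?thesis .
qed

lemma q_power_diff:
  assumes "even b" "a + b = c"
  shows "real q ^ a / real q ^ c = neg_inv ^ b"
  using assms q_ge_2 by (auto simp: power_add power_divide power_minus_even)

text \<open>With \<open>r = M - s\<close> the exponent is
  \<open>2 * (M - s) * (M + s) = 2 * M^2 - 2 * s^2\<close>. What remains is an even power of
  \<open>1 / q\<close>, so it may be written with base \<open>neg_inv\<close>.\<close>

lemma i_U_even:
  "real (i_U TYPE('a) (2 * M) q) / real q ^ (2 * (M * M)) =
    (\<Sum>s\<le>M. neg_inv ^ (2 * (s * s)) * (qpoch neg_inv (2 * M) / (qpoch neg_inv (M - s) * qpoch neg_inv (2 * s))))"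
  unfolding i_U_eq_sum[OF disjI1[OF refl]] sum_divide_distrib
proof (intro sum.cong refl)
  fix s assume "s \<in> {..M}"
  then obtain t where M: "M = s + t" using le_Suc_ex by auto
  have "real q ^ (2 * (t * (2 * M - t))) / real q ^ (2 * (M * M)) = neg_inv ^ (2 * (s * s))"
    by (intro q_power_diff) (simp_all add: M algebra_simps)
  moreover have "M - s = t" "2 * M - 2 * t = 2 * s" by (simp_all add: M)
  moreover have "A * P / R / C = A / C * (P / R)" for A P R C :: real by simp
  ultimately show "real q ^ (2 * ((M - s) * (2 * M - (M - s)))) * qpoch neg_inv (2 * M) /
      (qpoch neg_inv (M - s) * qpoch neg_inv (2 * M - 2 * (M - s))) / real q ^ (2 * (M * M)) =
      neg_inv ^ (2 * (s * s)) * (qpoch neg_inv (2 * M) / (qpoch neg_inv (M - s) * qpoch neg_inv (2 * s)))"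
    by (simp only:)
qed

lemma i_U_odd:
  "real (i_U TYPE('a) (Suc (2 * M)) q) / real q ^ (2 * (M * Suc M)) =
    (\<Sum>s\<le>M. neg_inv ^ (2 * (s * Suc s)) *
      (qpoch neg_inv (Suc (2 * M)) / (qpoch neg_inv (M - s) * qpoch neg_inv (Suc (2 * s)))))"
  unfolding i_U_eq_sum[OF disjI2[OF refl]] sum_divide_distrib
proof (intro sum.cong refl)
  fix s assume "s \<in> {..M}"
  then obtain t where M: "M = s + t" using le_Suc_ex by auto
  have "real q ^ (2 * (t * (Suc (2 * M) - t))) / real q ^ (2 * (M * Suc M)) = neg_inv ^ (2 * (s * Suc s))"
    by (intro q_power_diff) (simp_all add: M algebra_simps Suc_diff_le)
  moreover have "M - s = t" "Suc (2 * M) - 2 * t = Suc (2 * s)" by (simp_all add: M)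
  moreover have "A * P / R / C = A / C * (P / R)" for A P R C :: real by simp
  ultimately show "real q ^ (2 * ((M - s) * (Suc (2 * M) - (M - s)))) * qpoch neg_inv (Suc (2 * M)) /
      (qpoch neg_inv (M - s) * qpoch neg_inv (Suc (2 * M) - 2 * (M - s))) / real q ^ (2 * (M * Suc M)) =
      neg_inv ^ (2 * (s * Suc s)) * (qpoch neg_inv (Suc (2 * M)) / (qpoch neg_inv (M - s) * qpoch neg_inv (Suc (2 * s))))"
    by (simp only:)
qed

text \<open>For fixed \<open>s\<close>, numerator and first denominator tend to the same nonzero
  limit and cancel.\<close>

lemma sum_limit:
  fixes w :: "nat \<Rightarrow> real"
  assumes w: "summable (\<lambda>s. norm (w s))" and f: "filterlim f at_top sequentially"
  shows "(\<lambda>M. \<Sum>s\<le>M. w s * (qpoch neg_inv (f M) / (qpoch neg_inv (M - s) * qpoch neg_inv (h s)))) \<longlonglongrightarrow>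
    (\<Sum>s. w s / qpoch neg_inv (h s))"
proof -
  obtain l where l: "qpoch neg_inv \<longlonglongrightarrow> l" "l \<noteq> 0" by (rule qpoch_limit[OF neg_inv_bounds(3)])
  obtain B where B: "B \<ge> 0" "\<And>n. norm (qpoch neg_inv n) \<le> B" "\<And>n. norm (inverse (qpoch neg_inv n)) \<le> B"
    by (rule qpoch_bounds[OF neg_inv_bounds(3)]) auto
  have "(\<lambda>M. \<Sum>s\<le>M. w s * (qpoch neg_inv (f M) / (qpoch neg_inv (M - s) * qpoch neg_inv (h s)))) \<longlonglongrightarrow>
    (\<Sum>s. w s * (1 / qpoch neg_inv (h s)))"
  proof (rule tannery_truncated[OF w])
    fix s
    have "(\<lambda>M. qpoch neg_inv (f M) / (qpoch neg_inv (M - s) * qpoch neg_inv (h s))) \<longlonglongrightarrow> l / (l * qpoch neg_inv (h s))"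
      using l qpoch_nonzero[OF neg_inv_bounds(3)]
      by (intro tendsto_intros filterlim_compose[OF l(1)] f filterlim_minus_const_nat_at_top) auto
    then show "(\<lambda>M. qpoch neg_inv (f M) / (qpoch neg_inv (M - s) * qpoch neg_inv (h s))) \<longlonglongrightarrow> 1 / qpoch neg_inv (h s)"
      using l by simp
  next
    fix M s
    have "norm (qpoch neg_inv (f M) / (qpoch neg_inv (M - s) * qpoch neg_inv (h s))) =
        norm (qpoch neg_inv (f M)) * (norm (inverse (qpoch neg_inv (M - s))) * norm (inverse (qpoch neg_inv (h s))))"
      by (simp add: divide_inverse abs_mult)
    also have "\<dots> \<le> B * (B * B)"
      using B by (intro mult_mono) (auto intro: mult_nonneg_nonneg)
    finally show "norm (qpoch neg_inv (f M) / (qpoch neg_inv (M - s) * qpoch neg_inv (h s))) \<le> B * (B * B)" .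
  qed
  then show ?thesis by simp
qed

lemma powi_eq: "real q powi (- int e) = 1 / real q ^ e"
  by (simp add: power_int_minus divide_inverse)

text \<open>Oddness of \<open>a\<close> and \<open>b\<close> turns each plus sign into the minus
  sign of the stated product, and \<open>c = 8 - a\<close> compensates for the index
  \<open>Suc k\<close>. Positivity of \<open>S\<close> is passed on because a limit of partial
  products is identified with the infinite product when it is nonzero.\<close>

lemma prodinf_eq:
  assumes lim: "(\<lambda>n. \<Prod>k<n. (1 + neg_inv ^ (8 * k + a)) * (1 + neg_inv ^ (8 * k + b)) * (1 - neg_inv ^ (8 * k + 8)) /
      (1 - neg_inv ^ (2 * k + 2))) \<longlonglongrightarrow> S" and "S > 0" and odd: "odd a" "odd b"
    and cd: "c = 8 - int a" "d = 8 - int b"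
  shows "(\<Prod>k. (1 - real q powi (c - 8 * int (Suc k)))
                      * (1 - real q powi (d - 8 * int (Suc k)))
                      * (1 - real q powi (- 8 * int (Suc k)))
                      / (1 - real q powi (- 2 * int (Suc k)))) = S"
    (is "(\<Prod>k. ?f k) = S")
proof -
  have "?f k = (1 + neg_inv ^ (8 * k + a)) * (1 + neg_inv ^ (8 * k + b)) * (1 - neg_inv ^ (8 * k + 8)) / (1 - neg_inv ^ (2 * k + 2))"
    for k
  proof -
    have e: "c - 8 * int (Suc k) = - int (8 * k + a)" "d - 8 * int (Suc k) = - int (8 * k + b)"
      "- 8 * int (Suc k) = - int (8 * k + 8)" "- 2 * int (Suc k) = - int (2 * k + 2)"
      using cd by simp_all
    have "neg_inv ^ (8 * k + a) = - (1 / real q ^ (8 * k + a))" "neg_inv ^ (8 * k + b) = - (1 / real q ^ (8 * k + b))"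
      "neg_inv ^ (8 * k + 8) = 1 / real q ^ (8 * k + 8)" "neg_inv ^ (2 * k + 2) = 1 / real q ^ (2 * k + 2)"
      using odd by (simp_all only: power_divide) simp_all
    then show ?thesis unfolding e powi_eq by simp
  qed
  then have "(\<lambda>n. \<Prod>k<n. ?f k) \<longlonglongrightarrow> S" using lim by (simp only:)
  then have "(\<lambda>n. \<Prod>k\<le>n. ?f k) \<longlonglongrightarrow> S" by (simp only: LIMSEQ_lessThan_iff_atMost)
  then show ?thesis using \<open>S > 0\<close> by (intro prodinf_eq_prod_lim) auto
qed

end

section \<open>Limits along one parity and the conclusion\<close>

lemma tendsto_even_sequentially:
  fixes f :: "nat \<Rightarrow> 'a :: topological_space"
  assumes "(\<lambda>M. f (2 * M)) \<longlonglongrightarrow> l"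
  shows "(f \<longlongrightarrow> l) (inf sequentially (principal {n. even n}))"
proof (rule topological_tendstoI)
  fix S assume "open S" "l \<in> S"
  then have "eventually (\<lambda>M. f (2 * M) \<in> S) sequentially"
    using assms by (rule topological_tendstoD[rotated 1]) 
  then obtain N where N: "\<And>M. M \<ge> N \<Longrightarrow> f (2 * M) \<in> S" by (auto simp: eventually_sequentially)
  show "eventually (\<lambda>n. f n \<in> S) (inf sequentially (principal {n. even n}))"
    unfolding eventually_inf_principal eventually_sequentially
    using N by (intro exI[of _ "2 * N"]) (auto elim!: evenE)
qed

lemma tendsto_odd_sequentially:
  fixes f :: "nat \<Rightarrow> 'a :: topological_space"
  assumes "(\<lambda>M. f (Suc (2 * M))) \<longlonglongrightarrow> l"
  shows "(f \<longlongrightarrow> l) (inf sequentially (principal {n. odd n}))"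
proof (rule topological_tendstoI)
  fix S assume "open S" "l \<in> S"
  then have "eventually (\<lambda>M. f (Suc (2 * M)) \<in> S) sequentially"
    using assms by (rule topological_tendstoD[rotated 1])
  then obtain N where N: "\<And>M. M \<ge> N \<Longrightarrow> f (Suc (2 * M)) \<in> S" by (auto simp: eventually_sequentially)
  show "eventually (\<lambda>n. f n \<in> S) (inf sequentially (principal {n. odd n}))"
    unfolding eventually_inf_principal eventually_sequentially
    using N by (intro exI[of _ "2 * N"]) (auto elim!: oddE)
qed

theorem theorem3p5:
  fixes q m :: nat
  assumes "m \<ge> 1" and "q = 2 ^ m"
    and "CARD('a :: {field, finite}) = q ^ 2"
  shows "((\<lambda>n. real (i_U TYPE('a) n q) / real q powr (real n ^ 2 / 2))
            \<longlongrightarrow> (\<Prod>k. (1 - real q powi (3 - 8 * int (Suc k)))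
                      * (1 - real q powi (5 - 8 * int (Suc k)))
                      * (1 - real q powi (- 8 * int (Suc k)))
                      / (1 - real q powi (- 2 * int (Suc k)))))
          (inf sequentially (principal {n. even n}))
       \<and> ((\<lambda>n. real (i_U TYPE('a) n q) / real q powr ((real n ^ 2 - 1) / 2))
            \<longlongrightarrow> (\<Prod>k. (1 - real q powi (1 - 8 * int (Suc k)))
                      * (1 - real q powi (7 - 8 * int (Suc k)))
                      * (1 - real q powi (- 8 * int (Suc k)))
                      / (1 - real q powi (- 2 * int (Suc k)))))
          (inf sequentially (principal {n. odd n}))"
proof -
  interpret quadratic_field_char_2 q m "TYPE('a)"
    by (rule quadratic_field_char_2.intro[OF assms])
  have q: "real q > 0" using q_ge_2 by simp
  \<comment> \<open>The exponents are even, so every term is positive although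
    \<open>neg_inv\<close> is negative.\<close>
  have pos: "0 < (\<Sum>s. neg_inv ^ (2 * e s) / qpoch neg_inv (h s))"
    if "summable (\<lambda>s. norm (neg_inv ^ (2 * e s)))" for e h :: "nat \<Rightarrow> nat"
  proof (rule suminf_pos)
    show "summable (\<lambda>s. neg_inv ^ (2 * e s) / qpoch neg_inv (h s))"
      by (rule summable_weighted_quotient[OF neg_inv_bounds(3) that])
    show "0 < neg_inv ^ (2 * e s) / qpoch neg_inv (h s)" for s
      using q qpoch_pos[OF neg_inv_bounds(1,2)] by (intro divide_pos_pos) (simp_all add: power_mult)
  qed
  show ?thesis
  proof (intro conjI tendsto_even_sequentially tendsto_odd_sequentially)
    have "(\<lambda>M. real (i_U TYPE('a) (2 * M) q) / real q ^ (2 * (M * M))) \<longlonglongrightarrow>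
        (\<Sum>s. neg_inv ^ (2 * (s * s)) / qpoch neg_inv (2 * s))"
      unfolding i_U_even
      by (rule sum_limit[OF summable_weighted(1)[OF neg_inv_bounds(3)]])
        (auto intro!: filterlim_subseq simp: strict_mono_def)
    moreover have "real q powr (real (2 * M) ^ 2 / 2) = real q ^ (2 * (M * M))" for M
    proof -
      have "real (2 * M) ^ 2 / 2 = real (2 * (M * M))" by (simp add: power2_eq_square)
      then show ?thesis using powr_realpow[OF q] by (simp only:)
    qed
    moreover have "(\<Prod>k. (1 - real q powi (3 - 8 * int (Suc k))) * (1 - real q powi (5 - 8 * int (Suc k)))
          * (1 - real q powi (- 8 * int (Suc k))) / (1 - real q powi (- 2 * int (Suc k)))) =
        (\<Sum>s. neg_inv ^ (2 * (s * s)) / qpoch neg_inv (2 * s))"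
      by (rule prodinf_eq[OF real_slater_identities(1)[OF neg_inv_bounds(1,2)]
            pos[OF summable_weighted(1)[OF neg_inv_bounds(3)]]]) simp_all
    ultimately show "(\<lambda>M. real (i_U TYPE('a) (2 * M) q) / real q powr (real (2 * M) ^ 2 / 2)) \<longlonglongrightarrow>
        (\<Prod>k. (1 - real q powi (3 - 8 * int (Suc k))) * (1 - real q powi (5 - 8 * int (Suc k)))
          * (1 - real q powi (- 8 * int (Suc k))) / (1 - real q powi (- 2 * int (Suc k))))"
      by (simp only:)
    have "(\<lambda>M. real (i_U TYPE('a) (Suc (2 * M)) q) / real q ^ (2 * (M * Suc M))) \<longlonglongrightarrow>
        (\<Sum>s. neg_inv ^ (2 * (s * Suc s)) / qpoch neg_inv (Suc (2 * s)))"
      unfolding i_U_odd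
      by (rule sum_limit[OF summable_weighted(2)[OF neg_inv_bounds(3)]])
        (auto intro!: filterlim_subseq simp: strict_mono_def)
    moreover have "real q powr ((real (Suc (2 * M)) ^ 2 - 1) / 2) = real q ^ (2 * (M * Suc M))" for M
    proof -
      have "(real (Suc (2 * M)) ^ 2 - 1) / 2 = real (2 * (M * Suc M))"
        by (simp add: power2_eq_square algebra_simps)
      then show ?thesis using powr_realpow[OF q] by (simp only:)
    qed
    moreover have "(\<Prod>k. (1 - real q powi (1 - 8 * int (Suc k))) * (1 - real q powi (7 - 8 * int (Suc k)))
          * (1 - real q powi (- 8 * int (Suc k))) / (1 - real q powi (- 2 * int (Suc k)))) =
        (\<Sum>s. neg_inv ^ (2 * (s * Suc s)) / qpoch neg_inv (Suc (2 * s)))"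
      by (rule prodinf_eq[OF real_slater_identities(2)[OF neg_inv_bounds(1,2)]
            pos[OF summable_weighted(2)[OF neg_inv_bounds(3)]]]) simp_all
    ultimately show "(\<lambda>M. real (i_U TYPE('a) (Suc (2 * M)) q) /
          real q powr ((real (Suc (2 * M)) ^ 2 - 1) / 2)) \<longlonglongrightarrow>
        (\<Prod>k. (1 - real q powi (1 - 8 * int (Suc k))) * (1 - real q powi (7 - 8 * int (Suc k)))
          * (1 - real q powi (- 8 * int (Suc k))) / (1 - real q powi (- 2 * int (Suc k))))"
      by (simp only:)
  qed
qed

end
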